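(* Let $G$ be a finite group, $\mathcal C\subset G$ a conjugation-stable subset not containing the identity $e$, and let $D\!\!\!\!/$ be a Dirac operator on $\mathbb C[G]\otimes W$ built from gamma-matrices $\{\gamma_a\}_{a\in\mathcal C}\subset\mathrm{End}(W)$. A necessary condition for the Connes exterior algebra induced by $D\!\!\!\!/$ to contain the relations of the Woronowicz bicovariant one on $\mathbb C[G]$ is $$\gamma_a^2=0\quad\text{if }a^2\in\mathcal C\cup\{e\},\ a\in\mathcal C,\qquad \sum_{a,b\in\mathcal C,\;ab=g}\gamma_a\gamma_b=0\quad\forall g\in\mathcal C\cup\{e\}.$$
   Context: $H=\mathbb C[G]$ is the algebra of functions on $G$; $R_a(f)=f((\ )a)$ and $\partial^a=R_a-\mathrm{id}$. The calculus determined by $\mathcal C$ has $\Omega^1(H)$ free as a left $H$-module on $\{E_a\}_{a\in\mathcal C}$, $E_af=R_a(f)E_a$, $\mathrm df=\sum_a(\partial^af)E_a$. The Woronowicz exterior algebra is generated by $H$ and $\Omega^1(H)$, with $\mathrm d^2=0$ and with the additional relations given by $\ker(\mathrm{id}-\Psi)$, so that $\Omega^2(H)=\Omega^1(H)\otimes_H\Omega^1(H)/\ker(\mathrm{id}-\Psi)$, where $\Psi(E_a\otimes_HE_b)=E_{aba^{-1}}\otimes_HE_a$. The universal exterior algebra $\Omega^\cdot H$ is the universal differential graded algebra over $H$ (degree $n$ part inside $H^{\otimes(n+1)}$, $\mathrm df=1\otimes f-f\otimes1$); every exterior algebra on $H$ is a quotient of it by a differential graded ideal. $W$ is a vector space carrying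 a representation $\rho_W$ of $G$; the gamma-matrices are a collection of endomorphisms of $W$, and the Dirac operator on $H\otimes W$ is $D\!\!\!\!/=\sum_a\partial^a\gamma_a-\sum_{a,b}A_b{}^a\gamma_a\rho_W(b^{-1}-e)$ for functions $A_b{}^a\in H$ (components of a spin connection $A_b=\sum_aA_b{}^aE_a$). $H$ acts on $H\otimes W$ by multiplication. The representation $\pi_{D\!\!\!\!/}:\Omega^\cdot H\to\mathrm{End}(H\otimes W)$ is $f_0\,\mathrm df_1\cdots\mathrm df_n\mapsto f_0[D\!\!\!\!/,f_1]\cdots[D\!\!\!\!/,f_n]$, and the Connes exterior algebra $\Omega^\cdot_{D\!\!\!\!/}$ is the quotient of $\Omega^\cdot H$ by the differential graded ideal generated by $\ker\pi_{D\!\!\!\!/}$. It contains the relations of the Woronowicz one if every element of $\Omega^\cdot H$ mapping to zero in the Woronowicz exterior algebra maps to zero in $\Omega^\cdot_{D\!\!\!\!/}$.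
   Formalization: Each gamma-matrix γ_a (a in C) is assumed nonzero, and the Connes differential graded ideal is generated by the homogeneous elements of the kernel of the representation; without either the claim fails (Z_3 with γ_1=1, γ_2=0; Z_2 with γ_1=1). *)

theory Defs
  imports Complex_Main "HOL-Algebra.QuotRing"
begin

section \<open>Functions on the group\<close>

text \<open>Functions on \<^term>\<open>carrier G\<close> are functions on the ambient type that vanish outside the
  carrier. For values in \<^typ>\<open>complex\<close> this is the algebra \<open>H\<close>; for values in a complex vector
  space \<open>W\<close> it is \<open>H \<otimes> W\<close>, as \<open>G\<close> is finite.\<close>

definition funs_on :: "('g, 'm) monoid_scheme \<Rightarrow> ('g \<Rightarrow> 'b::zero) set" where
  "funs_on G = {f. \<forall>x. x \<notin> carrier G \<longrightarrow> f x = 0}"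

definition one_on :: "('g, 'm) monoid_scheme \<Rightarrow> 'g \<Rightarrow> complex" where
  "one_on G = (\<lambda>x. if x \<in> carrier G then 1 else 0)"

definition delta :: "'g \<Rightarrow> 'g \<Rightarrow> complex" where
  "delta x = (\<lambda>y. if y = x then 1 else 0)"

definition right_transl :: "('g, 'm) monoid_scheme \<Rightarrow> 'g \<Rightarrow> ('g \<Rightarrow> 'b::zero) \<Rightarrow> 'g \<Rightarrow> 'b" where
  "right_transl G a f = (\<lambda>x. if x \<in> carrier G then f (x \<otimes>\<^bsub>G\<^esub> a) else 0)"

definition pderiv_on :: "('g, 'm) monoid_scheme \<Rightarrow> 'g \<Rightarrow> ('g \<Rightarrow> 'b::ab_group_add) \<Rightarrow> 'g \<Rightarrow> 'b" where
  "pderiv_on G a f = (\<lambda>x. right_transl G a f x - f x)"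


section \<open>The universal exterior algebra\<close>

text \<open>Identify the \<open>(n+1)\<close>-fold tensor power of \<open>H\<close> with the functions on lists of length \<open>n + 1\<close>
  over \<open>G\<close>. The universal \<open>n\<close>-forms are the tensors killed by multiplying any two adjacent factors,
  i.e. the functions vanishing on lists with two equal adjacent entries. The product multiplies the
  last factor of the left tensor with the first factor of the right one, and \<open>d\<close> is the alternating
  sum of the insertions of \<open>1\<close>, so that \<open>df = 1 \<otimes> f - f \<otimes> 1\<close> (\<open>univ_d_emb\<close>) and
  \<open>d (f0 df1 \<dots> dfn) = df0 df1 \<dots> dfn\<close> (\<open>univ_d_mono\<close>).\<close>

definition univ_mult :: "('g list \<Rightarrow> complex) \<Rightarrow> ('g list \<Rightarrow> complex) \<Rightarrow> 'g list \<Rightarrow> complex" where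
  "univ_mult \<omega> \<eta> = (\<lambda>xs. \<Sum>i<length xs. \<omega> (take (Suc i) xs) * \<eta> (drop i xs))"

definition univ_emb :: "('g \<Rightarrow> complex) \<Rightarrow> 'g list \<Rightarrow> complex" where
  "univ_emb f = (\<lambda>xs. if length xs = 1 then f (hd xs) else 0)"

definition univ_forms :: "('g, 'm) monoid_scheme \<Rightarrow> ('g list \<Rightarrow> complex) ring" where
  "univ_forms G =
    \<lparr>carrier = {\<omega>. finite {xs. \<omega> xs \<noteq> 0} \<and>
        (\<forall>xs. \<omega> xs \<noteq> 0 \<longrightarrow> xs \<noteq> [] \<and> set xs \<subseteq> carrier G \<and> distinct_adj xs)},
     mult = univ_mult, one = univ_emb (one_on G), zero = (\<lambda>_. 0), add = (\<lambda>\<omega> \<eta> xs. \<omega> xs + \<eta> xs)\<rparr>"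

definition univ_part :: "nat \<Rightarrow> ('g list \<Rightarrow> complex) \<Rightarrow> 'g list \<Rightarrow> complex" where
  "univ_part n \<omega> = (\<lambda>xs. if length xs = Suc n then \<omega> xs else 0)"

definition univ_deg :: "('g, 'm) monoid_scheme \<Rightarrow> nat \<Rightarrow> ('g list \<Rightarrow> complex) set" where
  "univ_deg G n = {\<omega> \<in> carrier (univ_forms G). univ_part n \<omega> = \<omega>}"

definition univ_d :: "('g, 'm) monoid_scheme \<Rightarrow> ('g list \<Rightarrow> complex) \<Rightarrow> 'g list \<Rightarrow> complex" where
  "univ_d G \<omega> = (\<lambda>xs. \<Sum>i<length xs.
      (- 1) ^ i * one_on G (xs ! i) * \<omega> (take i xs @ drop (Suc i) xs))"

text \<open>\<open>univ_mono G f0 [f1, \<dots>, fn]\<close> is \<open>f0 df1 \<dots> dfn\<close>.\<close>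

definition univ_mono ::
    "('g, 'm) monoid_scheme \<Rightarrow> ('g \<Rightarrow> complex) \<Rightarrow> ('g \<Rightarrow> complex) list \<Rightarrow> 'g list \<Rightarrow> complex" where
  "univ_mono G f0 fs = univ_mult (univ_emb f0)
     (foldr (\<lambda>f. univ_mult (univ_d G (univ_emb f))) fs (univ_emb (one_on G)))"

definition dg_ideal :: "('g, 'm) monoid_scheme \<Rightarrow> ('g list \<Rightarrow> complex) set \<Rightarrow> bool" where
  "dg_ideal G J \<longleftrightarrow> ideal J (univ_forms G) \<and>
     (\<forall>\<omega>\<in>J. \<forall>n. univ_part n \<omega> \<in> J) \<and> (\<forall>\<omega>\<in>J. univ_d G \<omega> \<in> J)"


section \<open>The Woronowicz exterior algebra\<close>

text \<open>The tensor algebra of \<open>\<Omega>\<^sup>1(H)\<close> over \<open>H\<close> is free as a left \<open>H\<close>-module on the words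
  \<open>E\<^sub>a \<otimes> E\<^sub>b \<otimes> \<dots>\<close> with letters in \<open>C\<close>; \<open>t g w\<close> is the value at \<open>g\<close> of the coefficient of the word
  \<open>w\<close>. Moving a function to the left through a word \<open>[a, b, \<dots>]\<close> translates its argument to
  \<open>((g a) b) \<dots>\<close>.\<close>

definition tens_mult :: "('g, 'm) monoid_scheme \<Rightarrow> ('g \<Rightarrow> 'g list \<Rightarrow> complex) \<Rightarrow>
    ('g \<Rightarrow> 'g list \<Rightarrow> complex) \<Rightarrow> 'g \<Rightarrow> 'g list \<Rightarrow> complex" where
  "tens_mult G t u = (\<lambda>g w. \<Sum>i\<le>length w.
      t g (take i w) * u (foldl (\<otimes>\<^bsub>G\<^esub>) g (take i w)) (drop i w))"

definition tens_emb :: "('g \<Rightarrow> complex) \<Rightarrow> 'g \<Rightarrow> 'g list \<Rightarrow> complex" where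
  "tens_emb f = (\<lambda>g w. if w = [] then f g else 0)"

definition tens_E :: "('g, 'm) monoid_scheme \<Rightarrow> 'g \<Rightarrow> 'g \<Rightarrow> 'g list \<Rightarrow> complex" where
  "tens_E G a = (\<lambda>g w. if g \<in> carrier G \<and> w = [a] then 1 else 0)"

definition tens_alg :: "('g, 'm) monoid_scheme \<Rightarrow> 'g set \<Rightarrow> ('g \<Rightarrow> 'g list \<Rightarrow> complex) ring" where
  "tens_alg G C =
    \<lparr>carrier = {t. finite {(g, w). t g w \<noteq> 0} \<and> (\<forall>g w. t g w \<noteq> 0 \<longrightarrow> g \<in> carrier G \<and> set w \<subseteq> C)},
     mult = tens_mult G, one = tens_emb (one_on G), zero = (\<lambda>_ _. 0), add = (\<lambda>t u g w. t g w + u g w)\<rparr>"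

definition braiding :: "('g, 'm) monoid_scheme \<Rightarrow> 'g set \<Rightarrow>
    ('g \<Rightarrow> 'g list \<Rightarrow> complex) \<Rightarrow> 'g \<Rightarrow> 'g list \<Rightarrow> complex" where
  "braiding G C t = (\<lambda>g w. \<Sum>a\<in>C. \<Sum>b\<in>C.
      t g [a, b] * (if w = [a \<otimes>\<^bsub>G\<^esub> b \<otimes>\<^bsub>G\<^esub> inv\<^bsub>G\<^esub> a, a] then 1 else 0))"

definition woronowicz_rels :: "('g, 'm) monoid_scheme \<Rightarrow> 'g set \<Rightarrow> ('g \<Rightarrow> 'g list \<Rightarrow> complex) set" where
  "woronowicz_rels G C = {t \<in> carrier (tens_alg G C).
      (\<forall>g w. t g w \<noteq> 0 \<longrightarrow> length w = 2) \<and> braiding G C t = t}"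

definition woronowicz_ideal :: "('g, 'm) monoid_scheme \<Rightarrow> 'g set \<Rightarrow> ('g \<Rightarrow> 'g list \<Rightarrow> complex) set" where
  "woronowicz_ideal G C = Idl\<^bsub>tens_alg G C\<^esub> (woronowicz_rels G C)"

definition woronowicz_alg ::
    "('g, 'm) monoid_scheme \<Rightarrow> 'g set \<Rightarrow> ('g \<Rightarrow> 'g list \<Rightarrow> complex) set ring" where
  "woronowicz_alg G C = tens_alg G C Quot woronowicz_ideal G C"

text \<open>The algebra map that is the identity on \<open>H\<close> and sends each universal \<open>df\<close> to
  \<open>\<Sum>\<^sub>a (\<partial>\<^sup>a f) E\<^sub>a\<close> (see \<open>univ_to_tens_mult\<close>, \<open>univ_to_tens_emb\<close>, \<open>univ_to_tens_d\<close> below): the word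
  \<open>[a, b, \<dots>]\<close> based at \<open>g\<close> corresponds to the list \<open>[g, g a, g a b, \<dots>]\<close>.\<close>

primrec word_path :: "('g, 'm) monoid_scheme \<Rightarrow> 'g \<Rightarrow> 'g list \<Rightarrow> 'g list" where
  "word_path G g [] = [g]"
| "word_path G g (a # w) = g # word_path G (g \<otimes>\<^bsub>G\<^esub> a) w"

definition univ_to_tens :: "('g, 'm) monoid_scheme \<Rightarrow> 'g set \<Rightarrow>
    ('g list \<Rightarrow> complex) \<Rightarrow> 'g \<Rightarrow> 'g list \<Rightarrow> complex" where
  "univ_to_tens G C \<omega> =
     (\<lambda>g w. if g \<in> carrier G \<and> set w \<subseteq> C then \<omega> (word_path G g w) else 0)"

definition to_woronowicz :: "('g, 'm) monoid_scheme \<Rightarrow> 'g set \<Rightarrow>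
    ('g list \<Rightarrow> complex) \<Rightarrow> ('g \<Rightarrow> 'g list \<Rightarrow> complex) set" where
  "to_woronowicz G C \<omega> = woronowicz_ideal G C +>\<^bsub>tens_alg G C\<^esub> univ_to_tens G C \<omega>"


section \<open>Dirac operators and the Connes exterior algebra\<close>

definition linear_rep :: "('g, 'm) monoid_scheme \<Rightarrow> (complex \<Rightarrow> 'w \<Rightarrow> 'w::ab_group_add) \<Rightarrow>
    ('g \<Rightarrow> 'w \<Rightarrow> 'w) \<Rightarrow> bool" where
  "linear_rep G sc \<rho> \<longleftrightarrow> (\<forall>g\<in>carrier G. Vector_Spaces.linear sc sc (\<rho> g)) \<and>
     \<rho> \<one>\<^bsub>G\<^esub> = id \<and> (\<forall>g\<in>carrier G. \<forall>h\<in>carrier G. \<rho> (g \<otimes>\<^bsub>G\<^esub> h) = \<rho> g \<circ> \<rho> h)"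

text \<open>\<open>A b a\<close> is the component \<open>A\<^sub>b\<^sup>a\<close>, i.e. the coefficient of \<open>E\<^sub>a\<close> in \<open>A\<^sub>b\<close>.\<close>

definition dirac :: "('g, 'm) monoid_scheme \<Rightarrow> 'g set \<Rightarrow> (complex \<Rightarrow> 'w \<Rightarrow> 'w::ab_group_add) \<Rightarrow>
    ('g \<Rightarrow> 'w \<Rightarrow> 'w) \<Rightarrow> ('g \<Rightarrow> 'w \<Rightarrow> 'w) \<Rightarrow> ('g \<Rightarrow> 'g \<Rightarrow> 'g \<Rightarrow> complex) \<Rightarrow> ('g \<Rightarrow> 'w) \<Rightarrow> 'g \<Rightarrow> 'w" where
  "dirac G C sc \<rho> \<gamma> A \<psi> = (\<lambda>x. (\<Sum>a\<in>C. \<gamma> a (pderiv_on G a \<psi> x)) -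
     (\<Sum>a\<in>C. \<Sum>b\<in>C. sc (A b a x) (\<gamma> a (\<rho> (inv\<^bsub>G\<^esub> b) (\<psi> x) - \<rho> \<one>\<^bsub>G\<^esub> (\<psi> x)))))"

definition fun_act :: "(complex \<Rightarrow> 'w \<Rightarrow> 'w) \<Rightarrow> ('g \<Rightarrow> complex) \<Rightarrow> ('g \<Rightarrow> 'w) \<Rightarrow> 'g \<Rightarrow> 'w" where
  "fun_act sc f \<psi> = (\<lambda>x. sc (f x) (\<psi> x))"

definition commutator :: "(complex \<Rightarrow> 'w \<Rightarrow> 'w::ab_group_add) \<Rightarrow> (('g \<Rightarrow> 'w) \<Rightarrow> 'g \<Rightarrow> 'w) \<Rightarrow>
    ('g \<Rightarrow> complex) \<Rightarrow> ('g \<Rightarrow> 'w) \<Rightarrow> 'g \<Rightarrow> 'w" where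
  "commutator sc D f \<psi> = (\<lambda>x. D (fun_act sc f \<psi>) x - fun_act sc f (D \<psi>) x)"

text \<open>\<open>mono_op sc D f0 [f1, \<dots>, fn]\<close> is \<open>f0 [D, f1] \<dots> [D, fn]\<close>.\<close>

definition mono_op :: "(complex \<Rightarrow> 'w \<Rightarrow> 'w::ab_group_add) \<Rightarrow> (('g \<Rightarrow> 'w) \<Rightarrow> 'g \<Rightarrow> 'w) \<Rightarrow>
    ('g \<Rightarrow> complex) \<Rightarrow> ('g \<Rightarrow> complex) list \<Rightarrow> ('g \<Rightarrow> 'w) \<Rightarrow> 'g \<Rightarrow> 'w" where
  "mono_op sc D f0 fs = fun_act sc f0 \<circ> foldr (\<lambda>f T. commutator sc D f \<circ> T) fs id"

text \<open>Every universal form is the combination of the forms \<open>\<delta>\<^sub>x\<^sub>0 d\<delta>\<^sub>x\<^sub>1 \<dots> d\<delta>\<^sub>x\<^sub>n\<close> with coefficients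
  its values on the lists \<open>[x0, \<dots>, xn]\<close>, so the following is the linear map
  \<open>f0 df1 \<dots> dfn \<mapsto> f0 [D, f1] \<dots> [D, fn]\<close>, see \<open>connes_rep_mono\<close> below.\<close>

definition connes_rep :: "(complex \<Rightarrow> 'w \<Rightarrow> 'w::ab_group_add) \<Rightarrow> (('g \<Rightarrow> 'w) \<Rightarrow> 'g \<Rightarrow> 'w) \<Rightarrow>
    ('g list \<Rightarrow> complex) \<Rightarrow> ('g \<Rightarrow> 'w) \<Rightarrow> 'g \<Rightarrow> 'w" where
  "connes_rep sc D \<omega> \<psi> = (\<lambda>x. \<Sum>xs | \<omega> xs \<noteq> 0.
      sc (\<omega> xs) (mono_op sc D (delta (hd xs)) (map delta (tl xs)) \<psi> x))"

text \<open>As usual for the Connes construction, the kernel is taken degree by degree. The representation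
  does not respect degrees, and homogeneous components of an inhomogeneous element of its kernel
  are not relations.\<close>

definition connes_ker :: "('g, 'm) monoid_scheme \<Rightarrow> (complex \<Rightarrow> 'w \<Rightarrow> 'w::ab_group_add) \<Rightarrow>
    (('g \<Rightarrow> 'w) \<Rightarrow> 'g \<Rightarrow> 'w) \<Rightarrow> ('g list \<Rightarrow> complex) set" where
  "connes_ker G sc D = (\<Union>n. {\<omega> \<in> univ_deg G n. \<forall>\<psi>\<in>funs_on G. connes_rep sc D \<omega> \<psi> = (\<lambda>_. 0)})"

definition connes_ideal :: "('g, 'm) monoid_scheme \<Rightarrow> (complex \<Rightarrow> 'w \<Rightarrow> 'w::ab_group_add) \<Rightarrow>
    (('g \<Rightarrow> 'w) \<Rightarrow> 'g \<Rightarrow> 'w) \<Rightarrow> ('g list \<Rightarrow> complex) set" where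
  "connes_ideal G sc D = \<Inter>{J. dg_ideal G J \<and> connes_ker G sc D \<subseteq> J}"

definition connes_alg :: "('g, 'm) monoid_scheme \<Rightarrow> (complex \<Rightarrow> 'w \<Rightarrow> 'w::ab_group_add) \<Rightarrow>
    (('g \<Rightarrow> 'w) \<Rightarrow> 'g \<Rightarrow> 'w) \<Rightarrow> ('g list \<Rightarrow> complex) set ring" where
  "connes_alg G sc D = univ_forms G Quot connes_ideal G sc D"

definition to_connes :: "('g, 'm) monoid_scheme \<Rightarrow> (complex \<Rightarrow> 'w \<Rightarrow> 'w::ab_group_add) \<Rightarrow>
    (('g \<Rightarrow> 'w) \<Rightarrow> 'g \<Rightarrow> 'w) \<Rightarrow> ('g list \<Rightarrow> complex) \<Rightarrow> ('g list \<Rightarrow> complex) set" where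
  "to_connes G sc D \<omega> = connes_ideal G sc D +>\<^bsub>univ_forms G\<^esub> \<omega>"

definition contains_woronowicz_rels :: "('g, 'm) monoid_scheme \<Rightarrow> 'g set \<Rightarrow>
    (complex \<Rightarrow> 'w \<Rightarrow> 'w::ab_group_add) \<Rightarrow> (('g \<Rightarrow> 'w) \<Rightarrow> 'g \<Rightarrow> 'w) \<Rightarrow> bool" where
  "contains_woronowicz_rels G C sc D \<longleftrightarrow> (\<forall>\<omega>\<in>carrier (univ_forms G).
     to_woronowicz G C \<omega> = \<zero>\<^bsub>woronowicz_alg G C\<^esub> \<longrightarrow> to_connes G sc D \<omega> = \<zero>\<^bsub>connes_alg G sc D\<^esub>)"


section \<open>Consistency of the definitions\<close>

lemma sum_triangle:
  fixes f :: "nat \<Rightarrow> nat \<Rightarrow> nat \<Rightarrow> 'a::comm_monoid_add"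
  shows "(\<Sum>j\<le>k. \<Sum>i\<le>j. f i (j - i) (n - j)) = (\<Sum>j\<le>k. \<Sum>i\<le>k - j. f j i (n - j - i))"
  by (induct k) (simp_all add: Suc_diff_le sum.distrib add.assoc)

lemma univ_mult_Cons:
  "univ_mult \<omega> \<eta> (x # xs) = (\<Sum>i\<le>length xs. \<omega> (x # take i xs) * \<eta> (drop i (x # xs)))"
  by (simp add: univ_mult_def lessThan_Suc_atMost)

lemma univ_mult_Nil [simp]: "univ_mult \<omega> \<eta> [] = 0"
  by (simp add: univ_mult_def)

lemma univ_mult_assoc: "univ_mult (univ_mult \<omega> \<eta>) \<theta> = univ_mult \<omega> (univ_mult \<eta> \<theta>)"
proof
  fix xs
  show "univ_mult (univ_mult \<omega> \<eta>) \<theta> xs = univ_mult \<omega> (univ_mult \<eta> \<theta>) xs"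
  proof (cases xs)
  case (Cons x ys)
  define n where "n = length ys"
  define f where "f i k m = \<omega> (take (Suc i) xs) * \<eta> (take (Suc k) (drop i xs)) * \<theta> (drop (n - m) xs)" for i k m
  have len: "length xs = Suc n" using Cons by (simp add: n_def)
  have "univ_mult (univ_mult \<omega> \<eta>) \<theta> xs =
      (\<Sum>j\<le>n. (\<Sum>i\<le>j. \<omega> (take (Suc i) xs) * \<eta> (drop i (take (Suc j) xs))) * \<theta> (drop j xs))"
    unfolding univ_mult_def len lessThan_Suc_atMost
    by (intro sum.cong refl arg_cong2[where f = "(*)"])
       (auto simp: len min_def lessThan_Suc_atMost intro!: sum.cong)
  also have "\<dots> = (\<Sum>j\<le>n. \<Sum>i\<le>j. f i (j - i) (n - j))"
    unfolding sum_distrib_right f_def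
    by (intro sum.cong refl) (auto simp: drop_take Suc_diff_le)
  also have "\<dots> = (\<Sum>j\<le>n. \<Sum>i\<le>n - j. f j i (n - j - i))"
    by (rule sum_triangle)
  also have "\<dots> = univ_mult \<omega> (univ_mult \<eta> \<theta>) xs"
    unfolding univ_mult_def len lessThan_Suc_atMost sum_distrib_left f_def
    by (intro sum.cong refl) (auto simp: len Suc_diff_le lessThan_Suc_atMost mult.assoc add.commute intro!: sum.cong)
  finally show ?thesis .
  qed simp
qed

lemma univ_mult_emb_left: "univ_mult (univ_emb f) \<omega> xs = (if xs = [] then 0 else f (hd xs) * \<omega> xs)"
proof (cases xs)
  case (Cons x ys)
  have "univ_mult (univ_emb f) \<omega> xs = (\<Sum>i\<le>length ys. if i = 0 then f x * \<omega> xs else 0)"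
    unfolding Cons univ_mult_Cons by (intro sum.cong) (auto simp: univ_emb_def)
  then show ?thesis using Cons by simp
qed simp

lemma univ_mult_emb_right: "univ_mult \<omega> (univ_emb f) xs = (if xs = [] then 0 else \<omega> xs * f (last xs))"
proof (cases xs)
  case (Cons x ys)
  have "univ_mult \<omega> (univ_emb f) xs = (\<Sum>i\<le>length ys. if i = length ys then \<omega> xs * f (last xs) else 0)"
    unfolding Cons univ_mult_Cons
  proof (intro sum.cong refl)
    fix i assume "i \<in> {..length ys}"
    then show "\<omega> (x # take i ys) * univ_emb f (drop i (x # ys)) =
        (if i = length ys then \<omega> (x # ys) * f (last (x # ys)) else 0)"
      by (cases "i = length ys") (auto simp: univ_emb_def hd_drop_conv_nth last_conv_nth)
  qed
  then show ?thesis using Cons by simp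
qed simp

lemma univ_mult_closed:
  assumes "\<omega> \<in> carrier (univ_forms G)" "\<eta> \<in> carrier (univ_forms G)"
  shows "univ_mult \<omega> \<eta> \<in> carrier (univ_forms G)"
proof -
  have ex: "\<exists>i<length xs. \<omega> (take (Suc i) xs) \<noteq> 0 \<and> \<eta> (drop i xs) \<noteq> 0"
    if "univ_mult \<omega> \<eta> xs \<noteq> 0" for xs
  proof (rule ccontr)
    assume "\<not> ?thesis"
    then have "univ_mult \<omega> \<eta> xs = 0" unfolding univ_mult_def by (intro sum.neutral) auto
    with that show False by simp
  qed
  have split: "take (Suc i) xs @ tl (drop i xs) = xs" for i and xs :: "'a list"
    by (simp add: drop_Suc[symmetric] tl_drop)
  have "{xs. univ_mult \<omega> \<eta> xs \<noteq> 0} \<subseteq>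
      (\<lambda>(ys, zs). ys @ tl zs) ` ({ys. \<omega> ys \<noteq> 0} \<times> {zs. \<eta> zs \<noteq> 0})"
  proof
    fix xs assume "xs \<in> {xs. univ_mult \<omega> \<eta> xs \<noteq> 0}"
    then obtain i where "\<omega> (take (Suc i) xs) \<noteq> 0" "\<eta> (drop i xs) \<noteq> 0" using ex by blast
    then show "xs \<in> (\<lambda>(ys, zs). ys @ tl zs) ` ({ys. \<omega> ys \<noteq> 0} \<times> {zs. \<eta> zs \<noteq> 0})"
      by (intro image_eqI[where x = "(take (Suc i) xs, drop i xs)"]) (auto simp: split simp del: take_Suc)
  qed
  moreover have "finite ({ys. \<omega> ys \<noteq> 0} \<times> {zs. \<eta> zs \<noteq> 0})"
    using assms by (simp add: univ_forms_def)
  ultimately have fin: "finite {xs. univ_mult \<omega> \<eta> xs \<noteq> 0}" by (metis finite_surj)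
  have "xs \<noteq> [] \<and> set xs \<subseteq> carrier G \<and> distinct_adj xs" if nz: "univ_mult \<omega> \<eta> xs \<noteq> 0" for xs
  proof -
    obtain i where i: "i < length xs" "\<omega> (take (Suc i) xs) \<noteq> 0" "\<eta> (drop i xs) \<noteq> 0"
      using ex[OF nz] by blast
    then have l: "set (take (Suc i) xs) \<subseteq> carrier G" "distinct_adj (take (Suc i) xs)"
      and r: "set (drop i xs) \<subseteq> carrier G" "distinct_adj (drop i xs)"
      using assms by (auto simp: univ_forms_def)
    have "set xs = set (take (Suc i) xs) \<union> set (drop (Suc i) xs)"
      by (metis append_take_drop_id set_append)
    moreover have "set (drop (Suc i) xs) \<subseteq> set (drop i xs)"
      by (simp add: set_drop_subset_set_drop)
    moreover have "xs ! k \<noteq> xs ! Suc k" if k: "Suc k < length xs" for k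
    proof (cases "k < i")
      case True
      then show ?thesis using distinct_adj_nth[OF l(2), of k] i(1) by simp
    next
      case False
      then show ?thesis using distinct_adj_nth[OF r(2), of "k - i"] i(1) k by simp
    qed
    ultimately show ?thesis using l(1) r(1) i(1) by (auto simp: distinct_adj_conv_nth)
  qed
  with fin show ?thesis by (simp add: univ_forms_def)
qed

lemma univ_emb_closed:
  assumes "finite (carrier G)" "f \<in> funs_on G"
  shows "univ_emb f \<in> carrier (univ_forms G)"
proof -
  have "{xs. univ_emb f xs \<noteq> 0} \<subseteq> (\<lambda>x. [x]) ` carrier G"
    using assms(2) by (auto simp: univ_emb_def funs_on_def length_Suc_conv split: if_splits)
  then have "finite {xs. univ_emb f xs \<noteq> 0}" using assms(1) by (metis finite_surj)
  then show ?thesis using assms(2)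
    by (auto simp: univ_forms_def univ_emb_def funs_on_def length_Suc_conv split: if_splits)
qed

lemma univ_forms_simps:
  "mult (univ_forms G) = univ_mult" "one (univ_forms G) = univ_emb (one_on G)"
  "zero (univ_forms G) = (\<lambda>_. 0)" "add (univ_forms G) = (\<lambda>\<omega> \<eta> xs. \<omega> xs + \<eta> xs)"
  by (simp_all add: univ_forms_def)

lemma ring_univ_forms:
  assumes "finite (carrier G)"
  shows "ring (univ_forms G)"
proof (rule ringI)
  have add_cl: "(\<lambda>xs. \<omega> xs + \<eta> xs) \<in> carrier (univ_forms G)"
    if "\<omega> \<in> carrier (univ_forms G)" "\<eta> \<in> carrier (univ_forms G)" for \<omega> \<eta>
  proof -
    have "{xs. \<omega> xs + \<eta> xs \<noteq> 0} \<subseteq> {xs. \<omega> xs \<noteq> 0} \<union> {xs. \<eta> xs \<noteq> 0}" by auto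
    moreover have "finite ({xs. \<omega> xs \<noteq> 0} \<union> {xs. \<eta> xs \<noteq> 0})"
      using that by (simp add: univ_forms_def)
    ultimately have "finite {xs. \<omega> xs + \<eta> xs \<noteq> 0}" by (rule finite_subset)
    moreover have "\<omega> xs \<noteq> 0 \<or> \<eta> xs \<noteq> 0" if "\<omega> xs + \<eta> xs \<noteq> 0" for xs
      using that by auto
    ultimately show ?thesis using that unfolding univ_forms_def by fastforce
  qed
  show "abelian_group (univ_forms G)"
  proof (rule abelian_groupI)
    fix \<omega> assume "\<omega> \<in> carrier (univ_forms G)"
    then show "\<exists>\<eta>\<in>carrier (univ_forms G). \<eta> \<oplus>\<^bsub>univ_forms G\<^esub> \<omega> = \<zero>\<^bsub>univ_forms G\<^esub>"
      by (intro bexI[where x = "\<lambda>xs. - \<omega> xs"]) (auto simp: univ_forms_def)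
  next
    show "\<zero>\<^bsub>univ_forms G\<^esub> \<in> carrier (univ_forms G)" by (simp add: univ_forms_def)
  qed (simp_all only: univ_forms_simps add_cl ac_simps add_0)
  show "monoid (univ_forms G)"
  proof (rule monoidI)
    show "\<one>\<^bsub>univ_forms G\<^esub> \<in> carrier (univ_forms G)"
      using univ_emb_closed[OF assms, of "one_on G"] by (simp add: univ_forms_simps funs_on_def one_on_def)
  next
    fix \<omega> assume "\<omega> \<in> carrier (univ_forms G)"
    then have s: "\<omega> xs \<noteq> 0 \<Longrightarrow> xs \<noteq> [] \<and> set xs \<subseteq> carrier G" for xs by (simp add: univ_forms_def)
    show "\<one>\<^bsub>univ_forms G\<^esub> \<otimes>\<^bsub>univ_forms G\<^esub> \<omega> = \<omega>"
      unfolding univ_forms_simps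
    proof
      fix xs show "univ_mult (univ_emb (one_on G)) \<omega> xs = \<omega> xs"
        using s[of xs] hd_in_set[of xs] by (cases "\<omega> xs = 0") (auto simp: univ_mult_emb_left one_on_def)
    qed
    show "\<omega> \<otimes>\<^bsub>univ_forms G\<^esub> \<one>\<^bsub>univ_forms G\<^esub> = \<omega>"
      unfolding univ_forms_simps
    proof
      fix xs show "univ_mult \<omega> (univ_emb (one_on G)) xs = \<omega> xs"
        using s[of xs] last_in_set[of xs] by (cases "\<omega> xs = 0") (auto simp: univ_mult_emb_right one_on_def)
    qed
  qed (auto simp: univ_forms_simps univ_mult_assoc intro: univ_mult_closed)
qed (simp_all add: univ_forms_simps univ_mult_def sum.distrib distrib_left distrib_right)

lemma tens_mult_assoc: "tens_mult G (tens_mult G t u) v = tens_mult G t (tens_mult G u v)"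
proof (intro ext)
  fix g :: 'a and w :: "'a list"
  define n where "n = length w"
  define e where "e i = foldl (\<otimes>\<^bsub>G\<^esub>) g (take i w)" for i
  define f where "f i k m = t g (take i w) * u (e i) (take k (drop i w)) * v (e (n - m)) (drop (n - m) w)" for i k m
  have e: "foldl (\<otimes>\<^bsub>G\<^esub>) (e i) (take k (drop i w)) = e (i + k)" for i k
    unfolding e_def foldl_append[symmetric] by (simp add: take_add)
  have "tens_mult G (tens_mult G t u) v g w =
      (\<Sum>j\<le>n. (\<Sum>i\<le>j. t g (take i w) * u (e i) (take (j - i) (drop i w))) * v (e j) (drop j w))"
    unfolding tens_mult_def n_def e_def
    by (intro sum.cong refl arg_cong2[where f = "(*)"]) (auto simp: drop_take min_def intro!: sum.cong)
  also have "\<dots> = (\<Sum>j\<le>n. \<Sum>i\<le>j. f i (j - i) (n - j))"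
    unfolding sum_distrib_right f_def by (intro sum.cong refl) auto
  also have "\<dots> = (\<Sum>j\<le>n. \<Sum>i\<le>n - j. f j i (n - j - i))"
    by (rule sum_triangle)
  also have "\<dots> = (\<Sum>j\<le>n. t g (take j w) * (\<Sum>i\<le>n - j. u (e j) (take i (drop j w)) * v (e (j + i)) (drop (j + i) w)))"
    unfolding sum_distrib_left f_def by (intro sum.cong refl) (auto simp: mult.assoc)
  also have "\<dots> = tens_mult G t (tens_mult G u v) g w"
    unfolding tens_mult_def e_def[symmetric] n_def
    by (intro sum.cong refl arg_cong2[where f = "(*)"]) (auto simp: e add.commute)
  finally show "tens_mult G (tens_mult G t u) v g w = tens_mult G t (tens_mult G u v) g w" .
qed

lemma tens_mult_emb_left: "tens_mult G (tens_emb f) t g w = f g * t g w"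
proof -
  have "tens_mult G (tens_emb f) t g w = (\<Sum>i\<le>length w. if i = 0 then f g * t g w else 0)"
    unfolding tens_mult_def by (intro sum.cong) (auto simp: tens_emb_def)
  then show ?thesis by simp
qed

lemma tens_mult_emb_right: "tens_mult G t (tens_emb f) g w = t g w * f (foldl (\<otimes>\<^bsub>G\<^esub>) g w)"
proof -
  have "tens_mult G t (tens_emb f) g w =
      (\<Sum>i\<le>length w. if i = length w then t g w * f (foldl (\<otimes>\<^bsub>G\<^esub>) g w) else 0)"
    unfolding tens_mult_def by (intro sum.cong) (auto simp: tens_emb_def)
  then show ?thesis by simp
qed

lemma foldl_closed:
  assumes "group G" "g \<in> carrier G" "set w \<subseteq> carrier G"
  shows "foldl (\<otimes>\<^bsub>G\<^esub>) g w \<in> carrier G"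
  using assms(2,3)
  by (induction w arbitrary: g) (auto intro: monoid.m_closed[OF group.is_monoid[OF assms(1)]])

lemma tens_mult_closed:
  assumes "t \<in> carrier (tens_alg G C)" "u \<in> carrier (tens_alg G C)"
  shows "tens_mult G t u \<in> carrier (tens_alg G C)"
proof -
  have ex: "\<exists>i\<le>length w. t g (take i w) \<noteq> 0 \<and> u (foldl (\<otimes>\<^bsub>G\<^esub>) g (take i w)) (drop i w) \<noteq> 0"
    if "tens_mult G t u g w \<noteq> 0" for g w
  proof (rule ccontr)
    assume "\<not> ?thesis"
    then have "tens_mult G t u g w = 0" unfolding tens_mult_def by (intro sum.neutral) auto
    with that show False by simp
  qed
  have "{(g, w). tens_mult G t u g w \<noteq> 0} \<subseteq>
      (\<lambda>((g, w), (h, v)). (g, w @ v)) ` ({(g, w). t g w \<noteq> 0} \<times> {(g, w). u g w \<noteq> 0})"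
  proof clarify
    fix g w assume "tens_mult G t u g w \<noteq> 0"
    then obtain i where "t g (take i w) \<noteq> 0" "u (foldl (\<otimes>\<^bsub>G\<^esub>) g (take i w)) (drop i w) \<noteq> 0"
      using ex by blast
    then show "(g, w) \<in> (\<lambda>((g, w), (h, v)). (g, w @ v)) ` ({(g, w). t g w \<noteq> 0} \<times> {(g, w). u g w \<noteq> 0})"
      by (intro image_eqI[where x = "((g, take i w), (foldl (\<otimes>\<^bsub>G\<^esub>) g (take i w), drop i w))"]) simp_all
  qed
  moreover have "finite ({(g, w). t g w \<noteq> 0} \<times> {(g, w). u g w \<noteq> 0})"
    using assms by (simp add: tens_alg_def)
  ultimately have fin: "finite {(g, w). tens_mult G t u g w \<noteq> 0}" by (metis finite_surj)
  have "g \<in> carrier G \<and> set w \<subseteq> C" if nz: "tens_mult G t u g w \<noteq> 0" for g w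
  proof -
    obtain i where i: "t g (take i w) \<noteq> 0" "u (foldl (\<otimes>\<^bsub>G\<^esub>) g (take i w)) (drop i w) \<noteq> 0"
      using ex[OF nz] by blast
    then have "g \<in> carrier G" "set (take i w) \<subseteq> C" "set (drop i w) \<subseteq> C"
      using assms by (auto simp: tens_alg_def)
    moreover have "set w = set (take i w) \<union> set (drop i w)"
      by (metis append_take_drop_id set_append)
    ultimately show ?thesis by simp
  qed
  with fin show ?thesis by (simp add: tens_alg_def)
qed

lemma tens_emb_closed:
  assumes "finite (carrier G)" "f \<in> funs_on G"
  shows "tens_emb f \<in> carrier (tens_alg G C)"
proof -
  have "{(g, w). tens_emb f g w \<noteq> 0} \<subseteq> (\<lambda>x. (x, [])) ` carrier G"
    using assms(2) by (auto simp: tens_emb_def funs_on_def split: if_splits)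
  then have "finite {(g, w). tens_emb f g w \<noteq> 0}" using assms(1) by (metis finite_surj)
  then show ?thesis using assms(2)
    by (auto simp: tens_alg_def tens_emb_def funs_on_def split: if_splits)
qed

lemma tens_alg_simps:
  "mult (tens_alg G C) = tens_mult G" "one (tens_alg G C) = tens_emb (one_on G)"
  "zero (tens_alg G C) = (\<lambda>_ _. 0)" "add (tens_alg G C) = (\<lambda>t u g w. t g w + u g w)"
  by (simp_all add: tens_alg_def)

lemma ring_tens_alg:
  assumes "group G" "finite (carrier G)" "C \<subseteq> carrier G"
  shows "ring (tens_alg G C)"
proof (rule ringI)
  have add_cl: "(\<lambda>g w. t g w + u g w) \<in> carrier (tens_alg G C)"
    if "t \<in> carrier (tens_alg G C)" "u \<in> carrier (tens_alg G C)" for t u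
  proof -
    have "{(g, w). t g w + u g w \<noteq> 0} \<subseteq> {(g, w). t g w \<noteq> 0} \<union> {(g, w). u g w \<noteq> 0}" by auto
    moreover have "finite ({(g, w). t g w \<noteq> 0} \<union> {(g, w). u g w \<noteq> 0})"
      using that by (simp add: tens_alg_def)
    ultimately have "finite {(g, w). t g w + u g w \<noteq> 0}" by (rule finite_subset)
    moreover have "t g w \<noteq> 0 \<or> u g w \<noteq> 0" if "t g w + u g w \<noteq> 0" for g w
      using that by auto
    ultimately show ?thesis using that unfolding tens_alg_def by fastforce
  qed
  show "abelian_group (tens_alg G C)"
  proof (rule abelian_groupI)
    fix t assume "t \<in> carrier (tens_alg G C)"
    then show "\<exists>u\<in>carrier (tens_alg G C). u \<oplus>\<^bsub>tens_alg G C\<^esub> t = \<zero>\<^bsub>tens_alg G C\<^esub>"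
      by (intro bexI[where x = "\<lambda>g w. - t g w"]) (auto simp: tens_alg_def)
  next
    show "\<zero>\<^bsub>tens_alg G C\<^esub> \<in> carrier (tens_alg G C)" by (simp add: tens_alg_def)
  qed (simp_all only: tens_alg_simps add_cl ac_simps add_0)
  show "monoid (tens_alg G C)"
  proof (rule monoidI)
    show "\<one>\<^bsub>tens_alg G C\<^esub> \<in> carrier (tens_alg G C)"
      using tens_emb_closed[OF assms(2), of "one_on G"] by (simp add: tens_alg_simps funs_on_def one_on_def)
  next
    fix t assume "t \<in> carrier (tens_alg G C)"
    then have s: "t g w \<noteq> 0 \<Longrightarrow> g \<in> carrier G \<and> set w \<subseteq> carrier G" for g w
      using assms(3) by (auto simp: tens_alg_def)
    show "\<one>\<^bsub>tens_alg G C\<^esub> \<otimes>\<^bsub>tens_alg G C\<^esub> t = t"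
      unfolding tens_alg_simps using s by (fastforce simp: tens_mult_emb_left one_on_def fun_eq_iff)
    show "t \<otimes>\<^bsub>tens_alg G C\<^esub> \<one>\<^bsub>tens_alg G C\<^esub> = t"
      unfolding tens_alg_simps
    proof (intro ext)
      fix g w show "tens_mult G t (tens_emb (one_on G)) g w = t g w"
        using s[of g w] foldl_closed[OF assms(1), of g w]
        by (auto simp: tens_mult_emb_right one_on_def)
    qed
  qed (auto simp: tens_alg_simps tens_mult_assoc intro: tens_mult_closed)
qed (simp_all add: tens_alg_simps tens_mult_def sum.distrib distrib_left distrib_right)

lemma tens_E_emb:
  assumes "group G" "a \<in> carrier G"
  shows "tens_mult G (tens_E G a) (tens_emb f) = tens_mult G (tens_emb (right_transl G a f)) (tens_E G a)"
  by (intro ext) (simp add: tens_mult_emb_left tens_mult_emb_right tens_E_def right_transl_def)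

lemma length_word_path [simp]: "length (word_path G g w) = Suc (length w)"
  by (induction w arbitrary: g) auto

lemma take_word_path: "i \<le> length w \<Longrightarrow> take (Suc i) (word_path G g w) = word_path G g (take i w)"
proof (induction w arbitrary: g i)
  case (Cons a w)
  then show ?case by (cases i) auto
qed simp

lemma drop_word_path:
  "i \<le> length w \<Longrightarrow> drop i (word_path G g w) = word_path G (foldl (\<otimes>\<^bsub>G\<^esub>) g (take i w)) (drop i w)"
proof (induction w arbitrary: g i)
  case (Cons a w)
  then show ?case by (cases i) auto
qed simp

lemma univ_to_tens_mult:
  assumes "group G" "C \<subseteq> carrier G"
  shows "univ_to_tens G C (univ_mult \<omega> \<eta>) = tens_mult G (univ_to_tens G C \<omega>) (univ_to_tens G C \<eta>)"
proof (intro ext)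
  fix g w
  show "univ_to_tens G C (univ_mult \<omega> \<eta>) g w = tens_mult G (univ_to_tens G C \<omega>) (univ_to_tens G C \<eta>) g w"
  proof (cases "g \<in> carrier G \<and> set w \<subseteq> C")
    case True
    have st: "set (take i w) \<subseteq> C" "set (drop i w) \<subseteq> C" for i
      using True set_take_subset[of i w] set_drop_subset[of i w] by auto
    have cl: "foldl (\<otimes>\<^bsub>G\<^esub>) g (take i w) \<in> carrier G" for i
      using foldl_closed[OF assms(1), of g "take i w"] st(1)[of i] True assms(2) by auto
    show ?thesis
      unfolding univ_to_tens_def tens_mult_def univ_mult_def using True
      by (auto simp: lessThan_Suc_atMost take_word_path drop_word_path st cl simp del: take_Suc intro!: sum.cong)
  next
    case False
    then have "\<not> (g \<in> carrier G \<and> set (take i w) \<subseteq> C \<and> set (drop i w) \<subseteq> C)" for i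
      by (metis append_take_drop_id set_append Un_least)
    then have "tens_mult G (univ_to_tens G C \<omega>) (univ_to_tens G C \<eta>) g w = 0"
      unfolding univ_to_tens_def tens_mult_def by (intro sum.neutral) auto
    then show ?thesis using False by (simp only: univ_to_tens_def if_False)
  qed
qed

lemma univ_to_tens_emb:
  assumes "f \<in> funs_on G"
  shows "univ_to_tens G C (univ_emb f) = tens_emb f"
  using assms by (intro ext) (auto simp: univ_to_tens_def univ_emb_def tens_emb_def funs_on_def)

lemma univ_d_emb:
  assumes "f \<in> funs_on G"
  shows "univ_d G (univ_emb f) = (\<lambda>xs. if length xs = 2 then
      one_on G (hd xs) * f (last xs) - f (hd xs) * one_on G (last xs) else 0)"
proof
  fix xs :: "'a list"
  show "univ_d G (univ_emb f) xs = (if length xs = 2 then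
      one_on G (hd xs) * f (last xs) - f (hd xs) * one_on G (last xs) else 0)"
  proof (cases "length xs = 2")
    case True
    then obtain x y where "xs = [x, y]" by (auto simp: length_Suc_conv numeral_2_eq_2)
    then show ?thesis by (simp add: univ_d_def univ_emb_def lessThan_Suc)
  next
    case False
    then show ?thesis unfolding univ_d_def univ_emb_def by (auto intro!: sum.neutral)
  qed
qed

lemma univ_to_tens_d:
  assumes "group G" "finite (carrier G)" "C \<subseteq> carrier G" "f \<in> funs_on G"
  shows "univ_to_tens G C (univ_d G (univ_emb f)) =
    (\<lambda>g w. \<Sum>a\<in>C. tens_mult G (tens_emb (pderiv_on G a f)) (tens_E G a) g w)"
proof (intro ext)
  fix g w
  have fin: "finite C" using assms(2,3) finite_subset by blast
  show "univ_to_tens G C (univ_d G (univ_emb f)) g w =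
    (\<Sum>a\<in>C. tens_mult G (tens_emb (pderiv_on G a f)) (tens_E G a) g w)"
  proof (cases "\<exists>a. w = [a]")
    case True
    then obtain a where w: "w = [a]" by blast
    have "(\<Sum>b\<in>C. tens_mult G (tens_emb (pderiv_on G b f)) (tens_E G b) g w) =
       (\<Sum>b\<in>C. if b = a then (if g \<in> carrier G then pderiv_on G a f g else 0) else 0)"
      by (intro sum.cong) (auto simp: tens_mult_emb_left tens_E_def w)
    also have "\<dots> = (if g \<in> carrier G \<and> a \<in> C then pderiv_on G a f g else 0)"
      using fin by simp
    also have "\<dots> = univ_to_tens G C (univ_d G (univ_emb f)) g w"
      using assms monoid.m_closed[OF group.is_monoid[OF assms(1)], of g a]
      by (auto simp: univ_to_tens_def univ_d_emb w pderiv_on_def right_transl_def one_on_def)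
    finally show ?thesis by simp
  next
    case False
    then have "length w \<noteq> 1" by (auto simp: length_Suc_conv)
    then show ?thesis using False
      by (simp add: univ_to_tens_def univ_d_emb[OF assms(4)] tens_mult_emb_left tens_E_def)
  qed
qed

lemma univ_d_Cons:
  "univ_d G \<omega> (x # xs) = one_on G x * \<omega> xs - univ_d G (\<lambda>ys. \<omega> (x # ys)) xs"
  by (simp add: univ_d_def sum.lessThan_Suc_shift sum_negf del: sum.lessThan_Suc)


lemma one_on_apply: "one_on G x = (if x \<in> carrier G then 1 else 0)"
  by (simp add: one_on_def)

lemma univ_mono_Nil [simp]: "univ_mono G f0 fs [] = 0"
  by (simp add: univ_mono_def)

lemma univ_mono_base: "univ_mono G (one_on G) [] xs = (if \<exists>x\<in>carrier G. xs = [x] then 1 else 0)"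
proof -
  have "univ_mono G (one_on G) [] xs = (if xs = [] then 0 else one_on G (hd xs) * univ_emb (one_on G) xs)"
    by (simp add: univ_mono_def univ_mult_emb_left)
  then show ?thesis by (auto simp: univ_emb_def one_on_def length_Suc_conv split: if_splits)
qed

lemma univ_mono_step:
  assumes "f \<in> funs_on G"
  shows "univ_mono G (one_on G) (f # fs) [x] = 0"
    and "univ_mono G (one_on G) (f # fs) (x # y # ys) =
      (if x \<in> carrier G then (f y - f x) * univ_mono G (one_on G) fs (y # ys) else 0)"
proof -
  show "univ_mono G (one_on G) (f # fs) [x] = 0"
    by (simp add: univ_mono_def univ_mult_emb_left univ_mult_Cons univ_d_emb[OF assms])
  define M where "M = foldr (\<lambda>f. univ_mult (univ_d G (univ_emb f))) fs (univ_emb (one_on G))"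
  have "univ_mult (univ_d G (univ_emb f)) M (x # y # ys) =
      (\<Sum>i\<le>Suc (length ys). if i = 1 then (one_on G x * f y - f x * one_on G y) * M (y # ys) else 0)"
    unfolding univ_mult_Cons
  proof (intro sum.cong)
    fix i assume "i \<in> {..Suc (length ys)}"
    then show "univ_d G (univ_emb f) (x # take i (y # ys)) * M (drop i (x # y # ys)) =
        (if i = 1 then (one_on G x * f y - f x * one_on G y) * M (y # ys) else 0)"
      by (cases "i = 1") (auto simp: univ_d_emb[OF assms])
  qed simp
  also have "\<dots> = (one_on G x * f y - f x * one_on G y) * M (y # ys)"
    by (subst sum.delta) auto
  finally have "univ_mult (univ_d G (univ_emb f)) M (x # y # ys) =
      (one_on G x * f y - f x * one_on G y) * M (y # ys)" .
  then show "univ_mono G (one_on G) (f # fs) (x # y # ys) =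
      (if x \<in> carrier G then (f y - f x) * univ_mono G (one_on G) fs (y # ys) else 0)"
    using assms by (simp add: univ_mono_def univ_mult_emb_left M_def[symmetric] one_on_apply funs_on_def)
qed

lemma univ_mono_support:
  assumes "set fs \<subseteq> funs_on G" "univ_mono G (one_on G) fs xs \<noteq> 0"
  shows "set xs \<subseteq> carrier G \<and> length xs = Suc (length fs)"
  using assms
proof (induction fs arbitrary: xs)
  case Nil
  then show ?case by (auto simp: univ_mono_base split: if_splits)
next
  case (Cons f fs)
  from Cons.prems(1) have f: "f \<in> funs_on G" by simp
  show ?case
  proof (cases xs rule: remdups_adj.cases)
    case (3 x y ys)
    then show ?thesis using Cons.IH[of "y # ys"] Cons.prems by (auto simp: univ_mono_step[OF f] split: if_splits)
  qed (use Cons.prems univ_mono_step(1)[OF f] in auto)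
qed

lemma univ_mono_Cons:
  assumes "f0 \<in> funs_on G"
  shows "univ_mono G f0 fs (x # xs) = f0 x * univ_mono G (one_on G) fs (x # xs)"
  using assms by (simp add: univ_mono_def univ_mult_emb_left one_on_apply funs_on_def)

lemma univ_d_mono:
  assumes "f0 \<in> funs_on G" "set fs \<subseteq> funs_on G"
  shows "univ_d G (univ_mono G f0 fs) xs = univ_mono G (one_on G) (f0 # fs) xs"
  using assms
proof (induction fs arbitrary: f0 xs)
  case Nil
  have "univ_mono G f0 [] = univ_emb f0"
  proof
    fix xs
    have "univ_mono G f0 [] xs = (if xs = [] then 0 else f0 (hd xs) * univ_emb (one_on G) xs)"
      by (simp add: univ_mono_def univ_mult_emb_left)
    then show "univ_mono G f0 [] xs = univ_emb f0 xs"
      using Nil by (auto simp: univ_emb_def one_on_apply funs_on_def)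
  qed
  moreover have "univ_mono G (one_on G) [f0] xs = univ_d G (univ_emb f0) xs"
    using Nil by (cases xs rule: remdups_adj.cases)
      (auto simp: univ_d_emb univ_mono_step univ_mono_base one_on_apply funs_on_def neq_Nil_conv length_Suc_conv)
  ultimately show ?case by simp
next
  case (Cons f1 fs)
  have f: "f0 \<in> funs_on G" "f1 \<in> funs_on G" "set fs \<subseteq> funs_on G" using Cons.prems by auto
  have one: "one_on G \<in> funs_on G" by (simp add: funs_on_def one_on_apply)
  have d_lin: "univ_d G (\<lambda>ys. a * (\<omega> ys - b * \<eta> ys)) ys = a * (univ_d G \<omega> ys - b * univ_d G \<eta> ys)" for a b \<omega> \<eta> ys
    by (simp add: univ_d_def sum_distrib_left sum_subtractf[symmetric] algebra_simps)
  have dd: "univ_mono G (one_on G) (one_on G # fs) ys = 0" for ys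
  proof (cases ys rule: remdups_adj.cases)
    case (3 x y zs)
    then show ?thesis using univ_mono_support[OF f(3), of "y # zs"]
      by (auto simp: univ_mono_step[OF one] one_on_apply)
  qed (simp_all add: univ_mono_step[OF one])
  show ?case
  proof (cases xs)
    case Nil then show ?thesis by (simp add: univ_d_def)
  next
    case xs: (Cons x ys)
    have "(\<lambda>zs. univ_mono G f0 (f1 # fs) (x # zs)) =
        (\<lambda>zs. f0 x * (univ_mono G f1 fs zs - f1 x * univ_mono G (one_on G) fs zs))"
    proof
      fix zs show "univ_mono G f0 (f1 # fs) (x # zs) =
          f0 x * (univ_mono G f1 fs zs - f1 x * univ_mono G (one_on G) fs zs)"
        using f(1) by (cases zs) (auto simp: univ_mono_Cons[OF f(1)] univ_mono_Cons[OF f(2)]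
          univ_mono_step[OF f(2)] funs_on_def algebra_simps)
    qed
    then have "univ_d G (univ_mono G f0 (f1 # fs)) xs = one_on G x * univ_mono G f0 (f1 # fs) ys -
        f0 x * univ_mono G (one_on G) (f1 # fs) ys"
      unfolding xs univ_d_Cons using Cons.IH[OF f(2,3)] Cons.IH[OF one f(3)] by (simp add: d_lin dd)
    also have "\<dots> = univ_mono G (one_on G) (f0 # f1 # fs) xs"
      using f(1) by (cases ys) (auto simp: xs univ_mono_step[OF f(1)] univ_mono_Cons[OF f(1)]
        one_on_apply funs_on_def algebra_simps)
    finally show ?thesis .
  qed
qed

lemma sum_of_linear_op:
  fixes sc :: "complex \<Rightarrow> 'w \<Rightarrow> 'w::ab_group_add" and \<phi> :: "'i \<Rightarrow> 'g \<Rightarrow> 'w"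
  assumes "vector_space sc"
    and D_add: "\<And>\<psi> \<phi> x. \<psi> \<in> funs_on G \<Longrightarrow> \<phi> \<in> funs_on G \<Longrightarrow> D (\<lambda>x. \<psi> x + \<phi> x) x = D \<psi> x + D \<phi> x"
    and D_sc: "\<And>\<psi> c x. \<psi> \<in> funs_on G \<Longrightarrow> D (\<lambda>x. sc c (\<psi> x)) x = sc c (D \<psi> x)"
    and "finite I" "\<And>i. i \<in> I \<Longrightarrow> \<phi> i \<in> funs_on G"
  shows "D (\<lambda>x. \<Sum>i\<in>I. \<phi> i x) x = (\<Sum>i\<in>I. (D (\<phi> i) x :: 'w))"
  using assms(4,5)
proof (induction I)
  case empty
  interpret vector_space sc by fact
  have "(\<lambda>_. 0) \<in> funs_on G" by (simp add: funs_on_def)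
  from D_sc[OF this, of 0] show ?case by simp
next
  case (insert i I)
  have "(\<lambda>x. \<Sum>i\<in>I. \<phi> i x) \<in> funs_on G"
    using insert.prems by (auto simp: funs_on_def intro!: sum.neutral)
  then show ?case using insert by (simp add: D_add)
qed

lemma connes_rep_mono:
  fixes G :: "('g, 'm) monoid_scheme" and sc :: "complex \<Rightarrow> 'w \<Rightarrow> 'w::ab_group_add"
  assumes sc: "vector_space sc" and fin: "finite (carrier G)"
    and D_cl: "\<And>\<psi>. \<psi> \<in> funs_on G \<Longrightarrow> D \<psi> \<in> funs_on G"
    and D_add: "\<And>\<psi> \<phi> x. \<psi> \<in> funs_on G \<Longrightarrow> \<phi> \<in> funs_on G \<Longrightarrow> D (\<lambda>x. \<psi> x + \<phi> x) x = D \<psi> x + D \<phi> x"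
    and D_sc: "\<And>\<psi> c x. \<psi> \<in> funs_on G \<Longrightarrow> D (\<lambda>x. sc c (\<psi> x)) x = sc c (D \<psi> x)"
    and f0: "f0 \<in> funs_on G" and fs: "set fs \<subseteq> funs_on G" and \<psi>: "\<psi> \<in> funs_on G"
  shows "connes_rep sc D (univ_mono G f0 fs) \<psi> = mono_op sc D f0 fs \<psi>"
proof -
  interpret vector_space sc by fact
  define T where "T hs = foldr (\<lambda>f T. commutator sc D f \<circ> T) hs id \<psi>" for hs
  define K where "K n = {ys. set ys \<subseteq> carrier G \<and> length ys = n}" for n
  have finK: "finite (K n)" for n unfolding K_def using fin by (rule finite_lists_length_eq)
  have K_Suc: "K (Suc n) = (\<lambda>(y, ys). y # ys) ` (carrier G \<times> K n)" for n
    by (auto simp: K_def length_Suc_conv)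
  have sum_K: "(\<Sum>ys\<in>K (Suc n). h ys) = (\<Sum>y\<in>carrier G. \<Sum>ys\<in>K n. h (y # ys))" for n and h :: "_ \<Rightarrow> 'w"
    unfolding K_Suc by (subst sum.reindex) (auto simp: inj_on_def sum.cartesian_product case_prod_beta)
  have D_sum: "D (\<lambda>x. \<Sum>i\<in>I. \<phi> i x) x = (\<Sum>i\<in>I. D (\<phi> i) x)"
    if "finite I" "\<And>i. \<phi> i \<in> funs_on G" for I :: "'g set" and \<phi> x
    using sum_of_linear_op[where sc = sc and G = G and D = D and I = I and \<phi> = \<phi>] sc D_add D_sc that by blast
  have D_sum': "D (\<lambda>x. \<Sum>i\<in>I. \<phi> i x) x = (\<Sum>i\<in>I. D (\<phi> i) x)"
    if "finite I" "\<And>i. \<phi> i \<in> funs_on G" for I :: "'g list set" and \<phi> x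
    using sum_of_linear_op[where sc = sc and G = G and D = D and I = I and \<phi> = \<phi>] sc D_add D_sc that by blast
  have act_cl: "fun_act sc f \<phi> \<in> funs_on G" if "\<phi> \<in> funs_on G" for f \<phi>
    using that by (simp add: fun_act_def funs_on_def)
  have T_cl: "T hs \<in> funs_on G" for hs
  proof (induction hs)
    case Nil then show ?case using \<psi> by (simp add: T_def)
  next
    case (Cons h hs)
    have T: "T (h # hs) = commutator sc D h (T hs)" by (simp add: T_def)
    show ?case using D_cl[OF Cons] D_cl[OF act_cl[OF Cons, of h]]
      by (simp add: T commutator_def funs_on_def fun_act_def)
  qed
  have main: "(\<Sum>ys\<in>K (length fs). sc (univ_mono G (one_on G) fs (x # ys)) (T (map delta ys) x)) = T fs x"
    if "set fs \<subseteq> funs_on G" "x \<in> carrier G" for fs x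
    using that
  proof (induction fs arbitrary: x)
    case Nil
    have "K 0 = {[]}" by (auto simp: K_def)
    then show ?case using Nil by (simp add: univ_mono_base)
  next
    case (Cons f fs)
    have f: "f \<in> funs_on G" and fs: "set fs \<subseteq> funs_on G" using Cons.prems by auto
    let ?M = "univ_mono G (one_on G) fs"
    let ?u = "\<lambda>y zs. sc ((f y - f x) * ?M (y # zs))"
    let ?S = "\<lambda>zs. T (map delta zs)"
    have cl: "(\<lambda>z. ?u y zs (fun_act sc (delta y) (?S zs) z)) \<in> funs_on G" for y zs
      using act_cl[OF T_cl, of "delta y" "map delta zs"] by (simp add: funs_on_def)
    have cl2: "(\<lambda>z. \<Sum>zs\<in>K (length fs). ?u y zs (fun_act sc (delta y) (?S zs) z)) \<in> funs_on G" for y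
      using cl[of y] by (auto simp: funs_on_def intro!: sum.neutral)
    have "(\<Sum>ys\<in>K (length (f # fs)). sc (univ_mono G (one_on G) (f # fs) (x # ys)) (T (map delta ys) x)) =
        (\<Sum>y\<in>carrier G. \<Sum>zs\<in>K (length fs). ?u y zs (D (fun_act sc (delta y) (?S zs)) x))"
      unfolding length_Cons sum_K
    proof (intro sum.cong refl)
      fix y zs assume "y \<in> carrier G" "zs \<in> K (length fs)"
      have "T (map delta (y # zs)) x = D (fun_act sc (delta y) (?S zs)) x - sc (delta y x) (D (?S zs) x)"
        by (simp add: T_def commutator_def fun_act_def)
      moreover have "?u y zs (sc (delta y x) (D (?S zs) x)) = 0"
        by (simp add: delta_def)
      ultimately show "sc (univ_mono G (one_on G) (f # fs) (x # y # zs)) (T (map delta (y # zs)) x) =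
          ?u y zs (D (fun_act sc (delta y) (?S zs)) x)"
        using Cons.prems by (simp add: univ_mono_step(2)[OF f] scale_right_diff_distrib)
    qed
    also have "\<dots> = (\<Sum>y\<in>carrier G. \<Sum>zs\<in>K (length fs). D (\<lambda>z. ?u y zs (fun_act sc (delta y) (?S zs) z)) x)"
      by (simp add: D_sc[OF act_cl[OF T_cl]])
    also have "\<dots> = (\<Sum>y\<in>carrier G. D (\<lambda>z. \<Sum>zs\<in>K (length fs). ?u y zs (fun_act sc (delta y) (?S zs) z)) x)"
      by (simp add: D_sum'[OF finK cl])
    also have "\<dots> = D (\<lambda>z. \<Sum>y\<in>carrier G. \<Sum>zs\<in>K (length fs). ?u y zs (fun_act sc (delta y) (?S zs) z)) x"
      by (simp add: D_sum[OF fin cl2])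
    also have "(\<lambda>z. \<Sum>y\<in>carrier G. \<Sum>zs\<in>K (length fs). ?u y zs (fun_act sc (delta y) (?S zs) z)) =
        (\<lambda>z. fun_act sc f (T fs) z + sc (- f x) (T fs z))"
    proof
      fix z
      show "(\<Sum>y\<in>carrier G. \<Sum>zs\<in>K (length fs). ?u y zs (fun_act sc (delta y) (?S zs) z)) =
          fun_act sc f (T fs) z + sc (- f x) (T fs z)"
      proof (cases "z \<in> carrier G")
        case True
        have "(\<Sum>y\<in>carrier G. \<Sum>zs\<in>K (length fs). ?u y zs (fun_act sc (delta y) (?S zs) z)) =
            (\<Sum>y\<in>carrier G. if y = z then \<Sum>zs\<in>K (length fs). ?u z zs (?S zs z) else 0)"
          by (intro sum.cong) (auto simp: fun_act_def delta_def)
        also have "\<dots> = (\<Sum>zs\<in>K (length fs). sc (f z - f x) (sc (?M (z # zs)) (?S zs z)))"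
          using True fin by simp
        also have "\<dots> = sc (f z - f x) (T fs z)"
          by (simp only: scale_sum_right[symmetric] Cons.IH[OF fs True])
        finally show ?thesis by (simp add: fun_act_def scale_left_diff_distrib)
      next
        case False
        then show ?thesis using T_cl by (simp add: fun_act_def funs_on_def)
      qed
    qed
    also have "D \<dots> x = D (fun_act sc f (T fs)) x + sc (- f x) (D (T fs) x)"
    proof -
      have "(\<lambda>z. sc (- f x) (T fs z)) \<in> funs_on G" using T_cl[of fs] by (simp add: funs_on_def)
      from D_add[OF act_cl[OF T_cl] this] show ?thesis by (simp only: D_sc[OF T_cl])
    qed
    also have "\<dots> = T (f # fs) x"
      by (simp add: T_def commutator_def fun_act_def)
    finally show ?case .
  qed
  show ?thesis
  proof
    fix x
    let ?\<omega> = "univ_mono G f0 fs"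
    let ?op = "\<lambda>xs. mono_op sc D (delta (hd xs)) (map delta (tl xs)) \<psi> x"
    have supp: "{xs. ?\<omega> xs \<noteq> 0} \<subseteq> K (Suc (length fs))"
    proof
      fix xs assume "xs \<in> {xs. ?\<omega> xs \<noteq> 0}"
      then show "xs \<in> K (Suc (length fs))"
        using univ_mono_support[OF fs, of xs] by (cases xs) (auto simp: K_def univ_mono_Cons[OF f0])
    qed
    have "connes_rep sc D ?\<omega> \<psi> x = (\<Sum>xs\<in>K (Suc (length fs)). sc (?\<omega> xs) (?op xs))"
      unfolding connes_rep_def by (rule sum.mono_neutral_left[OF finK supp]) auto
    also have "\<dots> = (\<Sum>y\<in>carrier G. if y = x then
        \<Sum>ys\<in>K (length fs). sc (f0 x) (sc (univ_mono G (one_on G) fs (x # ys)) (T (map delta ys) x)) else 0)"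
      unfolding sum_K by (intro sum.cong refl)
        (auto simp: mono_op_def fun_act_def delta_def T_def[symmetric] univ_mono_Cons[OF f0])
    also have "\<dots> = (if x \<in> carrier G then sc (f0 x) (T fs x) else 0)"
      unfolding scale_sum_right[symmetric] using fin main[OF fs] by simp
    also have "\<dots> = mono_op sc D f0 fs \<psi> x"
      using f0 by (simp add: mono_op_def fun_act_def T_def funs_on_def)
    finally show "connes_rep sc D ?\<omega> \<psi> x = mono_op sc D f0 fs \<psi> x" .
  qed
qed


text \<open>The preceding lemma applies to the Dirac operators.\<close>

lemma dirac_linear:
  assumes "vector_space sc" "group G" "C \<subseteq> carrier G" "linear_rep G sc \<rho>"
    and \<gamma>: "\<And>a. a \<in> C \<Longrightarrow> Vector_Spaces.linear sc sc (\<gamma> a)"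
    and "\<And>a b. a \<in> C \<Longrightarrow> b \<in> C \<Longrightarrow> A b a \<in> funs_on G"
  shows "\<psi> \<in> funs_on G \<Longrightarrow> dirac G C sc \<rho> \<gamma> A \<psi> \<in> funs_on G"
    and "dirac G C sc \<rho> \<gamma> A (\<lambda>x. \<psi> x + \<phi> x) x = dirac G C sc \<rho> \<gamma> A \<psi> x + dirac G C sc \<rho> \<gamma> A \<phi> x"
    and "dirac G C sc \<rho> \<gamma> A (\<lambda>x. sc c (\<psi> x)) x = sc c (dirac G C sc \<rho> \<gamma> A \<psi> x)"
proof -
  interpret vector_space sc by fact
  interpret group G by fact
  note \<gamma>_hom = Vector_Spaces.linear.axioms(3)[OF \<gamma>]
  note g = Modules.module_hom.add[OF \<gamma>_hom] Modules.module_hom.scale[OF \<gamma>_hom] Modules.module_hom.zero[OF \<gamma>_hom]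
  have r: "Vector_Spaces.linear sc sc (\<rho> (inv\<^bsub>G\<^esub> b))" if "b \<in> C" for b
    using assms(4) subsetD[OF assms(3) that] by (simp add: linear_rep_def)
  note r_hom = Vector_Spaces.linear.axioms(3)[OF r]
  note r = Modules.module_hom.add[OF r_hom] Modules.module_hom.scale[OF r_hom] Modules.module_hom.zero[OF r_hom]
  have 1: "\<rho> \<one>\<^bsub>G\<^esub> = id" using assms(4) by (simp add: linear_rep_def)
  show "\<psi> \<in> funs_on G \<Longrightarrow> dirac G C sc \<rho> \<gamma> A \<psi> \<in> funs_on G"
  proof -
    assume \<psi>: "\<psi> \<in> funs_on G"
    have "dirac G C sc \<rho> \<gamma> A \<psi> x = 0" if x: "x \<notin> carrier G" for x
    proof -
      have "pderiv_on G a \<psi> x = 0" for a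
        using \<psi> x by (simp add: pderiv_on_def right_transl_def funs_on_def)
      then have "(\<Sum>a\<in>C. \<gamma> a (pderiv_on G a \<psi> x)) = 0"
        by (intro sum.neutral) (simp add: g(3))
      moreover have "sc (A b a x) v = 0" if "a \<in> C" "b \<in> C" for a b v
        using assms(6)[OF that] x by (simp add: funs_on_def)
      then have "(\<Sum>a\<in>C. \<Sum>b\<in>C. sc (A b a x) (\<gamma> a (\<rho> (inv\<^bsub>G\<^esub> b) (\<psi> x) - \<rho> \<one>\<^bsub>G\<^esub> (\<psi> x)))) = 0"
        by (intro sum.neutral ballI) (simp add: sum.neutral)
      ultimately show ?thesis by (simp add: dirac_def)
    qed
    then show ?thesis by (simp add: funs_on_def)
  qed
  have p: "pderiv_on G a (\<lambda>x. \<psi> x + \<phi> x) x = pderiv_on G a \<psi> x + pderiv_on G a \<phi> x"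
    "pderiv_on G a (\<lambda>x. sc c (\<psi> x)) x = sc c (pderiv_on G a \<psi> x)" for a
    by (simp_all add: pderiv_on_def right_transl_def scale_right_diff_distrib)
  have q: "\<gamma> a (\<rho> (inv\<^bsub>G\<^esub> b) (v + w) - (v + w)) = \<gamma> a (\<rho> (inv\<^bsub>G\<^esub> b) v - v) + \<gamma> a (\<rho> (inv\<^bsub>G\<^esub> b) w - w)"
    "\<gamma> a (\<rho> (inv\<^bsub>G\<^esub> b) (sc c v) - sc c v) = sc c (\<gamma> a (\<rho> (inv\<^bsub>G\<^esub> b) v - v))"
    if "a \<in> C" "b \<in> C" for a b v w
  proof -
    show "\<gamma> a (\<rho> (inv\<^bsub>G\<^esub> b) (v + w) - (v + w)) = \<gamma> a (\<rho> (inv\<^bsub>G\<^esub> b) v - v) + \<gamma> a (\<rho> (inv\<^bsub>G\<^esub> b) w - w)"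
      unfolding r(1)[OF that(2)] add_diff_add g(1)[OF that(1)] by (rule refl)
    show "\<gamma> a (\<rho> (inv\<^bsub>G\<^esub> b) (sc c v) - sc c v) = sc c (\<gamma> a (\<rho> (inv\<^bsub>G\<^esub> b) v - v))"
      unfolding r(2)[OF that(2)] scale_right_diff_distrib[symmetric] g(2)[OF that(1)] by (rule refl)
  qed
  have "(\<Sum>a\<in>C. \<gamma> a (pderiv_on G a (\<lambda>x. \<psi> x + \<phi> x) x)) =
      (\<Sum>a\<in>C. \<gamma> a (pderiv_on G a \<psi> x)) + (\<Sum>a\<in>C. \<gamma> a (pderiv_on G a \<phi> x))"
    unfolding sum.distrib[symmetric] by (intro sum.cong refl) (simp only: p g(1))
  moreover have "(\<Sum>a\<in>C. \<Sum>b\<in>C. sc (A b a x) (\<gamma> a (\<rho> (inv\<^bsub>G\<^esub> b) (\<psi> x + \<phi> x) - (\<psi> x + \<phi> x)))) =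
      (\<Sum>a\<in>C. \<Sum>b\<in>C. sc (A b a x) (\<gamma> a (\<rho> (inv\<^bsub>G\<^esub> b) (\<psi> x) - \<psi> x))) +
      (\<Sum>a\<in>C. \<Sum>b\<in>C. sc (A b a x) (\<gamma> a (\<rho> (inv\<^bsub>G\<^esub> b) (\<phi> x) - \<phi> x)))"
    unfolding sum.distrib[symmetric] by (intro sum.cong refl) (simp only: q(1) scale_right_distrib)
  ultimately show "dirac G C sc \<rho> \<gamma> A (\<lambda>x. \<psi> x + \<phi> x) x = dirac G C sc \<rho> \<gamma> A \<psi> x + dirac G C sc \<rho> \<gamma> A \<phi> x"
    unfolding dirac_def 1 id_apply by (simp only: add_diff_add)
  have "(\<Sum>a\<in>C. \<gamma> a (pderiv_on G a (\<lambda>x. sc c (\<psi> x)) x)) = sc c (\<Sum>a\<in>C. \<gamma> a (pderiv_on G a \<psi> x))"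
    unfolding scale_sum_right by (intro sum.cong refl) (simp only: p g(2))
  moreover have "(\<Sum>a\<in>C. \<Sum>b\<in>C. sc (A b a x) (\<gamma> a (\<rho> (inv\<^bsub>G\<^esub> b) (sc c (\<psi> x)) - sc c (\<psi> x)))) =
      sc c (\<Sum>a\<in>C. \<Sum>b\<in>C. sc (A b a x) (\<gamma> a (\<rho> (inv\<^bsub>G\<^esub> b) (\<psi> x) - \<psi> x)))"
    unfolding scale_sum_right by (intro sum.cong refl) (simp only: q(2) scale_scale mult.commute)
  ultimately show "dirac G C sc \<rho> \<gamma> A (\<lambda>x. sc c (\<psi> x)) x = sc c (dirac G C sc \<rho> \<gamma> A \<psi> x)"
    unfolding dirac_def 1 id_apply by (simp only: scale_right_diff_distrib)
qed

end

theory Submission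
  imports Defs
begin

text \<open>The commutators are \<open>([D, f] \<psi>)(x) = \<Sum>\<^sub>a (f(x a) - f(x)) \<gamma>\<^sub>a \<psi>(x a)\<close>, so the representation of
  a universal form is a sum over the words in \<open>C\<close>, the word \<open>a b \<dots>\<close> contributing
  \<open>\<gamma>\<^sub>a \<gamma>\<^sub>b \<dots>\<close> and moving \<open>x\<close> to \<open>x a b \<dots>\<close>. A 1-form \<open>\<omega>\<close> in the kernel vanishes on all edges
  \<open>(x, x a)\<close> with \<open>a \<in> C\<close>, because \<open>\<gamma>\<^sub>a \<noteq> 0\<close>. Hence the part of the operator of \<open>d\<omega>\<close> from \<open>x\<close> to
  \<open>x g\<close> is \<open>- \<omega>(x, x g) \<Sum>\<^sub>a\<^sub>b\<^sub>=\<^sub>g \<gamma>\<^sub>a \<gamma>\<^sub>b\<close>, which vanishes for \<open>g \<in> C \<union> {e}\<close>. The Connes ideal therefore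
  imposes no new relations on these parts of the 2-forms, and the Woronowicz relations
  \<open>\<Sum>\<^sub>a\<^sub>b\<^sub>=\<^sub>g E\<^sub>a E\<^sub>b\<close> and \<open>E\<^sub>a E\<^sub>a\<close> must be represented by \<open>0\<close> there.\<close>

section \<open>Products in low degree and closure of the universal forms under the
  differential\<close>

lemma univ_mult_short:
  "univ_mult \<omega> \<eta> [x] = \<omega> [x] * \<eta> [x]"
  "univ_mult \<omega> \<eta> [x, y] = \<omega> [x] * \<eta> [x, y] + \<omega> [x, y] * \<eta> [y]"
  "univ_mult \<omega> \<eta> [x, y, z] = \<omega> [x] * \<eta> [x, y, z] + \<omega> [x, y] * \<eta> [y, z] + \<omega> [x, y, z] * \<eta> [z]"
  by (simp_all add: univ_mult_def)

text \<open>At a repeated adjacent entry the two terms that delete one of its copies cancel by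
  opposite signs, and every other term still has the repetition. The statement is for arbitrary
  \<open>\<omega>\<close> because the induction passes to
  \<open>\<lambda>ys. \<omega> (x # ys)\<close>, which may be nonzero at \<open>[]\<close> and so
  need not be a form.\<close>

lemma univ_d_distinct_adj:
  assumes "\<And>xs. \<not> distinct_adj xs \<Longrightarrow> \<omega> xs = 0" "\<not> distinct_adj xs"
  shows "univ_d G \<omega> xs = 0"
  using assms
proof (induction xs arbitrary: \<omega> rule: induct_list012)
  case (3 x y zs)
  show ?case
  proof (cases "x = y")
    case True
    then have "(\<lambda>ys. \<omega> (x # y # ys)) = (\<lambda>_. 0)" using 3(3) by simp
    then show ?thesis using True by (simp add: univ_d_Cons) (simp add: univ_d_def)
  next
    case False
    then have nd: "\<not> distinct_adj (y # zs)" using 3(4) by simp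
    have "univ_d G (\<lambda>ys. \<omega> (x # ys)) (y # zs) = 0"
    proof (rule 3(2)[OF _ nd])
      show "\<omega> (x # ys) = 0" if "\<not> distinct_adj ys" for ys
        using that by (intro 3(3)) (auto simp: distinct_adj_Cons)
    qed
    then show ?thesis using 3(3)[OF nd] by (simp only: univ_d_Cons[of G \<omega> x]) simp
  qed
qed simp_all

lemma univ_forms_zeroI: "\<omega> \<in> carrier (univ_forms G) \<Longrightarrow>
    xs = [] \<or> \<not> set xs \<subseteq> carrier G \<or> \<not> distinct_adj xs \<Longrightarrow> \<omega> xs = 0"
  by (auto simp: univ_forms_def)

lemma univ_d_closed:
  assumes "finite (carrier G)" and \<omega>: "\<omega> \<in> carrier (univ_forms G)"
  shows "univ_d G \<omega> \<in> carrier (univ_forms G)"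
proof -
  \<comment> \<open>A nonzero term of \<open>univ_d G \<omega>\<close> at \<open>xs\<close> deletes
    an entry of \<open>xs\<close>, so \<open>xs\<close> arises from the support of
    \<open>\<omega>\<close> by inserting one group element; \<open>F\<close> collects all such
    lists.\<close>
  define F where "F = (\<lambda>(ys, i, x). take i ys @ x # drop i ys) `
    (SIGMA ys:{ys. \<omega> ys \<noteq> 0}. {..length ys} \<times> carrier G)"
  have fin: "finite F"
    unfolding F_def using assms by (auto simp: univ_forms_def)
  have main: "xs \<in> F \<and> set xs \<subseteq> carrier G \<and> xs \<noteq> []" if nz: "univ_d G \<omega> xs \<noteq> 0" for xs
  proof -
    obtain i where i: "i < length xs" "one_on G (xs ! i) \<noteq> 0" "\<omega> (take i xs @ drop (Suc i) xs) \<noteq> 0"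
    proof (rule ccontr)
      assume "\<not> thesis"
      with that have "univ_d G \<omega> xs = 0" unfolding univ_d_def by (intro sum.neutral) auto
      with nz show False by simp
    qed
    let ?ys = "take i xs @ drop (Suc i) xs"
    have x: "xs ! i \<in> carrier G" using i(2) by (simp add: one_on_def split: if_splits)
    have xs: "xs = take i ?ys @ xs ! i # drop i ?ys"
      using i(1) by (simp add: id_take_nth_drop[symmetric])
    moreover have "i \<le> length ?ys" using i(1) by simp
    ultimately have "xs \<in> F" unfolding F_def using x i(3)
      by (intro image_eqI[where x = "(?ys, i, xs ! i)"]) auto
    moreover have "set xs = insert (xs ! i) (set ?ys)"
      using arg_cong[OF id_take_nth_drop[OF i(1)], of set] by simp
    moreover have "set ?ys \<subseteq> carrier G" using univ_forms_zeroI[OF \<omega>, of ?ys] i(3) by blast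
    ultimately show ?thesis using x i(1) by auto
  qed
  have "{xs. univ_d G \<omega> xs \<noteq> 0} \<subseteq> F" using main by blast
  then have "finite {xs. univ_d G \<omega> xs \<noteq> 0}" using fin by (rule finite_subset)
  moreover have "distinct_adj xs" if "univ_d G \<omega> xs \<noteq> 0" for xs
    using that univ_d_distinct_adj[of \<omega>] \<omega> by (auto simp: univ_forms_def)
  ultimately show ?thesis using main by (simp add: univ_forms_def)
qed

lemma univ_part_closed: "\<omega> \<in> carrier (univ_forms G) \<Longrightarrow> univ_part n \<omega> \<in> carrier (univ_forms G)"
  by (auto simp: univ_forms_def univ_part_def elim!: rev_finite_subset)

section \<open>Paths traced by words in the group\<close>

lemma hd_word_path [simp]: "hd (word_path G g w) = g"
  by (cases w) auto

lemma word_path_not_Nil [simp]: "word_path G g w \<noteq> []" "[] \<noteq> word_path G g w"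
  by (cases w; auto)+

text \<open>Left cancellation recovers the letters one at a time from consecutive entries of the
  path.\<close>

lemma word_path_inject:
  assumes "group G" "set v \<subseteq> carrier G" "set w \<subseteq> carrier G" "g \<in> carrier G"
  shows "word_path G g v = word_path G g w \<longleftrightarrow> v = w"
proof
  interpret group G by fact
  show "word_path G g v = word_path G g w \<Longrightarrow> v = w"
    using assms(2-4)
  proof (induction v arbitrary: g w)
    case Nil
    then show ?case by (cases w) auto
  next
    case (Cons a v)
    then obtain b w' where w: "w = b # w'" by (cases w) auto
    with Cons.prems have p: "word_path G (g \<otimes>\<^bsub>G\<^esub> a) v = word_path G (g \<otimes>\<^bsub>G\<^esub> b) w'" by simp
    then have "g \<otimes>\<^bsub>G\<^esub> a = g \<otimes>\<^bsub>G\<^esub> b" by (metis hd_word_path)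
    then have "a = b" using Cons.prems w by simp
    then show ?case using Cons.IH[of "g \<otimes>\<^bsub>G\<^esub> a" w'] p Cons.prems w by simp
  qed
qed simp

section \<open>Commutators with the Dirac operator, and represented forms as sums over words\<close>

locale dirac_data = group G + vector_space sc
  for G :: "('g, 'm) monoid_scheme" (structure)
    and sc :: "complex \<Rightarrow> 'w \<Rightarrow> 'w::ab_group_add" +
  fixes C :: "'g set"
    and \<rho> \<gamma> :: "'g \<Rightarrow> 'w \<Rightarrow> 'w"
    and A :: "'g \<Rightarrow> 'g \<Rightarrow> 'g \<Rightarrow> complex"
  assumes finite_carrier: "finite (carrier G)"
    and C_subset: "C \<subseteq> carrier G"
    and one_notin: "\<one> \<notin> C"
    and conj_closed: "g \<in> carrier G \<Longrightarrow> c \<in> C \<Longrightarrow> g \<otimes> c \<otimes> inv g \<in> C"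
    and rep: "linear_rep G sc \<rho>"
    and linear_\<gamma>: "a \<in> C \<Longrightarrow> Vector_Spaces.linear sc sc (\<gamma> a)"
    and \<gamma>_nonzero: "a \<in> C \<Longrightarrow> \<gamma> a \<noteq> (\<lambda>_. 0)"
begin

abbreviation "D \<equiv> dirac G C sc \<rho> \<gamma> A"

lemma finite_C: "finite C"
  using C_subset finite_carrier finite_subset by blast

lemma C_carrier [simp]: "a \<in> C \<Longrightarrow> a \<in> carrier G"
  using C_subset by blast

lemmas \<gamma>_hom = Vector_Spaces.linear.axioms(3)[OF linear_\<gamma>]
lemmas \<gamma>_simps = Modules.module_hom.add[OF \<gamma>_hom] Modules.module_hom.scale[OF \<gamma>_hom]
  Modules.module_hom.zero[OF \<gamma>_hom] Modules.module_hom.diff[OF \<gamma>_hom]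

lemma foldr_\<gamma>_zero: "set w \<subseteq> C \<Longrightarrow> foldr \<gamma> w 0 = 0"
  by (induction w) (auto simp: \<gamma>_simps)

text \<open>The connection term acts pointwise in \<open>x\<close> and linearly, so it commutes with
  \<open>f\<close>. In the derivative term the contributions of \<open>\<psi> x\<close> cancel as
  well, which leaves only the translates.\<close>

lemma commutator_dirac:
  assumes "x \<in> carrier G"
  shows "commutator sc D f \<psi> x = (\<Sum>a\<in>C. sc (f (x \<otimes> a) - f x) (\<gamma> a (\<psi> (x \<otimes> a))))"
proof -
  have \<rho>: "\<rho> \<one> = id" "\<rho> (inv b) (sc c v) = sc c (\<rho> (inv b) v)" if "b \<in> C" for b c v
  proof -
    have "Vector_Spaces.linear sc sc (\<rho> (inv b))" using rep that by (simp add: linear_rep_def)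
    then show "\<rho> (inv b) (sc c v) = sc c (\<rho> (inv b) v)"
      by (rule Modules.module_hom.scale[OF Vector_Spaces.linear.axioms(3)])
  qed (use rep in \<open>simp add: linear_rep_def\<close>)
  let ?P = "\<lambda>\<phi>. \<Sum>a\<in>C. \<gamma> a (pderiv_on G a \<phi> x)"
  let ?S = "\<lambda>\<phi>. \<Sum>a\<in>C. \<Sum>b\<in>C. sc (A b a x) (\<gamma> a (\<rho> (inv b) (\<phi> x) - \<rho> \<one> (\<phi> x)))"
  have "?S (fun_act sc f \<psi>) = sc (f x) (?S \<psi>)"
    unfolding scale_sum_right
  proof (intro sum.cong refl)
    fix a b assume ab: "a \<in> C" "b \<in> C"
    have "\<gamma> a (\<rho> (inv b) (sc (f x) (\<psi> x)) - sc (f x) (\<psi> x)) = sc (f x) (\<gamma> a (\<rho> (inv b) (\<psi> x) - \<psi> x))"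
      using ab by (simp add: \<rho>(2) \<gamma>_simps scale_right_diff_distrib)
    then show "sc (A b a x) (\<gamma> a (\<rho> (inv b) (fun_act sc f \<psi> x) - \<rho> \<one> (fun_act sc f \<psi> x))) =
        sc (f x) (sc (A b a x) (\<gamma> a (\<rho> (inv b) (\<psi> x) - \<rho> \<one> (\<psi> x))))"
      using ab by (simp add: \<rho>(1) fun_act_def mult.commute)
  qed
  then have "commutator sc D f \<psi> x = ?P (fun_act sc f \<psi>) - sc (f x) (?P \<psi>)"
    unfolding commutator_def fun_act_def[of sc f "D \<psi>"] unfolding dirac_def
    by (simp add: scale_right_diff_distrib)
  also have "\<dots> = (\<Sum>a\<in>C. sc (f (x \<otimes> a) - f x) (\<gamma> a (\<psi> (x \<otimes> a))))"
    unfolding scale_sum_right sum_subtractf[symmetric]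
    using assms by (intro sum.cong refl)
      (simp add: pderiv_on_def right_transl_def fun_act_def \<gamma>_simps algebra_simps)
  finally show ?thesis .
qed

lemma commutator_delta:
  assumes "x \<in> carrier G" "x \<noteq> y"
  shows "commutator sc D (delta y) \<psi> x = (\<Sum>a\<in>C. if x \<otimes> a = y then \<gamma> a (\<psi> y) else 0)"
  unfolding commutator_dirac[OF assms(1)] using assms(2)
  by (intro sum.cong refl) (auto simp: delta_def)

text \<open>The part of \<open>mono_op\<close> after its leading function. A leading
  \<open>delta x\<close> only restricts to the base point \<open>x\<close>, so there it is enough to
  know the value of \<open>chain\<close> at \<open>x\<close>.\<close>

definition chain :: "'g list \<Rightarrow> ('g \<Rightarrow> 'w) \<Rightarrow> 'g \<Rightarrow> 'w" where
  "chain ys = foldr (\<lambda>f T. commutator sc D f \<circ> T) (map delta ys) id"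

lemma chain_simps [simp]:
  "chain [] \<psi> = \<psi>" "chain (y # ys) \<psi> = commutator sc D (delta y) (chain ys \<psi>)"
  by (simp_all add: chain_def)

text \<open>By left cancellation \<open>a\<close> is the only letter leading from \<open>x\<close>
  to \<open>x \<otimes> a\<close>, so each commutator contributes a single
  \<open>\<gamma> a\<close>. As the identity is not in \<open>C\<close>, the path moves at every
  step, which \<open>commutator_delta\<close> demands.\<close>

lemma chain_word_path:
  assumes "x \<in> carrier G" "set w \<subseteq> C"
  shows "chain (tl (word_path G x w)) \<psi> x = foldr \<gamma> w (\<psi> (foldl (\<otimes>) x w))"
  using assms
proof (induction w arbitrary: x)
  case (Cons a w)
  let ?y = "x \<otimes> a"
  have a: "a \<in> C" "a \<noteq> \<one>" and cl: "?y \<in> carrier G" using Cons.prems one_notin by auto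
  have eq: "word_path G ?y w = ?y # tl (word_path G ?y w)"
    by (metis hd_word_path list.collapse word_path_not_Nil(1))
  have "chain (tl (word_path G x (a # w))) \<psi> x =
      commutator sc D (delta ?y) (chain (tl (word_path G ?y w)) \<psi>) x"
    unfolding word_path.simps list.sel by (subst eq) simp
  also have "\<dots> = (\<Sum>b\<in>C. if x \<otimes> b = ?y then \<gamma> b (chain (tl (word_path G ?y w)) \<psi> ?y) else 0)"
    using Cons.prems a by (intro commutator_delta) auto
  also have "\<dots> = (\<Sum>b\<in>C. if b = a then \<gamma> b (chain (tl (word_path G ?y w)) \<psi> ?y) else 0)"
    using Cons.prems a by (intro sum.cong refl if_cong) auto
  also have "\<dots> = \<gamma> a (chain (tl (word_path G ?y w)) \<psi> ?y)"
    using a finite_C by simp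
  also have "\<dots> = foldr \<gamma> (a # w) (\<psi> (foldl (\<otimes>) x (a # w)))"
    using Cons.IH[OF cl] Cons.prems by simp
  finally show ?case .
qed simp

text \<open>By \<open>commutator_delta\<close> a nonzero value forces a letter of \<open>C\<close>
  leading to the next vertex, where the rest of the chain is again nonzero. Lists with a step
  outside \<open>C\<close> therefore drop out of the representation.\<close>

lemma chain_nonzero:
  assumes "x \<in> carrier G" "distinct_adj (x # ys)" "chain ys \<psi> x \<noteq> 0"
  obtains w where "set w \<subseteq> C" "x # ys = word_path G x w"
  using assms
proof (induction ys arbitrary: x thesis)
  case Nil
  show ?case using Nil.prems(1)[of "[]"] by simp
next
  case (Cons y ys)
  have "(\<Sum>a\<in>C. if x \<otimes> a = y then \<gamma> a (chain ys \<psi> y) else 0) \<noteq> 0"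
    using Cons.prems(2-4) commutator_delta[of x y "chain ys \<psi>"] by simp
  then obtain a where a: "a \<in> C" "x \<otimes> a = y" "\<gamma> a (chain ys \<psi> y) \<noteq> 0"
    by (auto elim!: sum.not_neutral_contains_not_neutral split: if_splits)
  then have "chain ys \<psi> y \<noteq> 0" by (auto simp: \<gamma>_simps)
  moreover have "y \<in> carrier G" using a Cons.prems(2) by auto
  ultimately obtain w where "set w \<subseteq> C" "y # ys = word_path G y w"
    using Cons.IH[of y] Cons.prems(3) by auto
  then show ?case using a Cons.prems(1)[of "a # w"] by simp
qed

lemma connes_rep_dirac:
  assumes \<omega>: "\<omega> \<in> univ_deg G n" and x: "x \<in> carrier G"
  shows "connes_rep sc D \<omega> \<psi> x =
    (\<Sum>w | set w \<subseteq> C \<and> length w = n. sc (\<omega> (word_path G x w)) (foldr \<gamma> w (\<psi> (foldl (\<otimes>) x w))))"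
    (is "_ = sum _ ?W")
proof -
  have cl: "\<omega> \<in> carrier (univ_forms G)" and part: "univ_part n \<omega> = \<omega>"
    using \<omega> by (auto simp: univ_deg_def)
  have supp: "xs \<noteq> [] \<and> distinct_adj xs \<and> length xs = Suc n" if "\<omega> xs \<noteq> 0" for xs
    using cl that fun_cong[OF part, of xs] by (auto simp: univ_forms_def univ_part_def split: if_splits)
  let ?h = "\<lambda>xs. sc (\<omega> xs) (mono_op sc D (delta (hd xs)) (map delta (tl xs)) \<psi> x)"
  let ?I = "word_path G x ` ?W"
  have h: "?h xs = sc (\<omega> xs) (if x = hd xs then chain (tl xs) \<psi> x else 0)" for xs
    by (simp add: mono_op_def fun_act_def delta_def chain_def)
  have fin: "finite {xs. \<omega> xs \<noteq> 0}" using cl by (simp add: univ_forms_def)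
  have finI: "finite ?I" using finite_lists_length_eq[OF finite_C] by blast
  \<comment> \<open>The support of \<open>\<omega>\<close> and the set of paths need not contain one
    another, so the sum is first extended to their union and then cut down to the paths by
    \<open>chain_nonzero\<close>.\<close>
  have "connes_rep sc D \<omega> \<psi> x = sum ?h ({xs. \<omega> xs \<noteq> 0} \<union> ?I)"
    unfolding connes_rep_def using fin finI by (intro sum.mono_neutral_left) auto
  also have "\<dots> = sum ?h ?I"
  proof (rule sum.mono_neutral_right)
    show "\<forall>xs\<in>({xs. \<omega> xs \<noteq> 0} \<union> ?I) - ?I. ?h xs = 0"
    proof (rule ballI, rule ccontr)
      fix xs assume xs: "xs \<in> ({xs. \<omega> xs \<noteq> 0} \<union> ?I) - ?I" and nz: "?h xs \<noteq> 0"
      then have s: "xs \<noteq> []" "distinct_adj xs" "length xs = Suc n" using supp by auto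
      from nz have "hd xs = x" and c: "chain (tl xs) \<psi> x \<noteq> 0" unfolding h by (auto split: if_splits)
      with s have xs_eq: "xs = x # tl xs" by auto
      with s(2) have "distinct_adj (x # tl xs)" by simp
      from chain_nonzero[OF x this c] obtain w where "set w \<subseteq> C" "xs = word_path G x w"
        using xs_eq by metis
      with xs s(3) show False by auto
    qed
  qed (use fin finI in auto)
  also have "\<dots> = (\<Sum>w\<in>?W. ?h (word_path G x w))"
  proof (rule sum.reindex_cong[OF _ refl refl], rule inj_onI)
    fix v w assume "v \<in> ?W" "w \<in> ?W" and eq: "word_path G x v = word_path G x w"
    then have "set v \<subseteq> carrier G" "set w \<subseteq> carrier G" using C_subset by auto
    then show "v = w" using eq word_path_inject[OF group_axioms _ _ x] by blast
  qed
  also have "\<dots> = (\<Sum>w\<in>?W. sc (\<omega> (word_path G x w)) (foldr \<gamma> w (\<psi> (foldl (\<otimes>) x w))))"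
    unfolding h using x by (intro sum.cong refl) (auto simp: chain_word_path)
  finally show ?thesis .
qed

text \<open>Testing on the section with value \<open>v\<close> at \<open>z\<close> and
  \<open>0\<close> elsewhere isolates the words leading from \<open>x\<close> to \<open>z\<close>;
  along all others the linear maps are applied to \<open>0\<close>.\<close>

lemma connes_ker_component:
  assumes \<omega>: "\<omega> \<in> univ_deg G n" "\<forall>\<psi>\<in>funs_on G. connes_rep sc D \<omega> \<psi> = (\<lambda>_. 0)"
    and "x \<in> carrier G" "z \<in> carrier G"
  shows "(\<Sum>w | set w \<subseteq> C \<and> length w = n.
    if foldl (\<otimes>) x w = z then sc (\<omega> (word_path G x w)) (foldr \<gamma> w v) else 0) = 0"
proof -
  let ?\<psi> = "\<lambda>y. if y = z then v else 0"
  have "(\<Sum>w | set w \<subseteq> C \<and> length w = n.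
      if foldl (\<otimes>) x w = z then sc (\<omega> (word_path G x w)) (foldr \<gamma> w v) else 0) = connes_rep sc D \<omega> ?\<psi> x"
    unfolding connes_rep_dirac[OF \<omega>(1) assms(3)]
    by (intro sum.cong refl) (auto simp: foldr_\<gamma>_zero)
  moreover have "?\<psi> \<in> funs_on G" using assms(4) by (auto simp: funs_on_def)
  ultimately show ?thesis using \<omega>(2) by simp
qed

section \<open>Sums over short words, and a differential graded ideal defined by conditions in low
  degree\<close>

lemma sum_words_2:
  "(\<Sum>w | set w \<subseteq> C \<and> length w = 2. h w) = (\<Sum>a\<in>C. \<Sum>b\<in>C. h [a, b])"
proof -
  have "{w. set w \<subseteq> C \<and> length w = 2} = (\<lambda>(a, b). [a, b]) ` (C \<times> C)"
    by (auto simp: length_Suc_conv numeral_2_eq_2)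
  then show ?thesis
    by (simp add: sum.reindex inj_on_def sum.cartesian_product case_prod_unfold)
qed

lemma sum_words_1:
  "(\<Sum>w | set w \<subseteq> C \<and> length w = 1. h w) = (\<Sum>a\<in>C. h [a])"
proof -
  have "{w. set w \<subseteq> C \<and> length w = 1} = (\<lambda>a. [a]) ` C"
    by (auto simp: length_Suc_conv)
  then show ?thesis by (simp add: sum.reindex inj_on_def)
qed

text \<open>The matrix entry from \<open>x\<close> to \<open>x \<otimes> g\<close> of a represented
  2-form. Writing the last vertex as \<open>x \<otimes> g\<close> keeps it free of the summation
  letters, so a factor depending only on the end points can be pulled out.\<close>

definition pair_sum :: "('g list \<Rightarrow> complex) \<Rightarrow> 'g \<Rightarrow> 'g \<Rightarrow> 'w \<Rightarrow> 'w" where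
  "pair_sum \<omega> x g v = (\<Sum>a\<in>C. \<Sum>b\<in>C.
     if a \<otimes> b = g then sc (\<omega> [x, x \<otimes> a, x \<otimes> g]) (\<gamma> a (\<gamma> b v)) else 0)"

text \<open>For \<open>C = {}\<close> the space \<open>W\<close> may be trivial, and then all functions lie in the kernel; hence the
  condition in degree 0 is only imposed for nonempty \<open>C\<close>.\<close>

definition low_ideal :: "('g list \<Rightarrow> complex) set" where
  "low_ideal = {\<omega> \<in> carrier (univ_forms G). \<forall>x\<in>carrier G.
     (\<forall>a\<in>C. \<omega> [x] = 0 \<and> \<omega> [x, x \<otimes> a] = 0) \<and> (\<forall>g\<in>C \<union> {\<one>}. \<forall>v. pair_sum \<omega> x g v = 0)}"

lemma low_idealI:
  assumes "\<omega> \<in> carrier (univ_forms G)"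
    and "\<And>x a. x \<in> carrier G \<Longrightarrow> a \<in> C \<Longrightarrow> \<omega> [x] = 0"
    and "\<And>x a. x \<in> carrier G \<Longrightarrow> a \<in> C \<Longrightarrow> \<omega> [x, x \<otimes> a] = 0"
    and "\<And>x g v. x \<in> carrier G \<Longrightarrow> g \<in> C \<union> {\<one>} \<Longrightarrow> pair_sum \<omega> x g v = 0"
  shows "\<omega> \<in> low_ideal"
  using assms unfolding low_ideal_def by blast

lemma low_idealD:
  assumes "\<omega> \<in> low_ideal"
  shows "\<omega> \<in> carrier (univ_forms G)"
    and "x \<in> carrier G \<Longrightarrow> a \<in> C \<Longrightarrow> \<omega> [x] = 0"
    and "x \<in> carrier G \<Longrightarrow> a \<in> C \<Longrightarrow> \<omega> [x, x \<otimes> a] = 0"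
    and "x \<in> carrier G \<Longrightarrow> g \<in> C \<union> {\<one>} \<Longrightarrow> pair_sum \<omega> x g v = 0"
  using assms unfolding low_ideal_def by blast+

text \<open>Negation, products, homogeneous parts and the differential all reduce to this:
  \<open>c\<close> is a sign, the value of the other factor at an end point, or a constant
  \<open>0\<close> or \<open>1\<close>.\<close>

lemma pair_sum_eq_smult:
  assumes "\<And>a b. a \<in> C \<Longrightarrow> b \<in> C \<Longrightarrow> a \<otimes> b = g \<Longrightarrow> \<omega> [x, x \<otimes> a, x \<otimes> g] = c * \<eta> [x, x \<otimes> a, x \<otimes> g]"
  shows "pair_sum \<omega> x g v = sc c (pair_sum \<eta> x g v)"
  unfolding pair_sum_def scale_sum_right
  using assms by (intro sum.cong refl) auto

text \<open>A product has three terms at \<open>[x, x \<otimes> a, x \<otimes> g]\<close>. Those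
  that evaluate the factor from \<open>low_ideal\<close> at a vertex or an edge vanish. The
  remaining term multiplies its value on the whole path by the value of the other factor at an end
  point, which is the same for all paths.\<close>

lemma ideal_low_ideal: "ideal low_ideal (univ_forms G)"
proof (rule idealI)
  show R: "ring (univ_forms G)" using finite_carrier by (rule ring_univ_forms)
  interpret R: ring "univ_forms G" by fact
  have neg: "\<ominus>\<^bsub>univ_forms G\<^esub> \<omega> = (\<lambda>xs. - \<omega> xs)" if "\<omega> \<in> carrier (univ_forms G)" for \<omega>
    using that by (intro R.minus_equality) (auto simp: univ_forms_def)
  show "subgroup low_ideal (add_monoid (univ_forms G))"
  proof (rule R.add.subgroupI)
    show "low_ideal \<subseteq> carrier (univ_forms G)" by (auto simp: low_ideal_def)
    have "(\<lambda>_. 0) \<in> low_ideal"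
      by (intro low_idealI) (auto simp: pair_sum_def univ_forms_def intro!: sum.neutral)
    then show "low_ideal \<noteq> {}" by blast
  next
    fix \<omega> assume \<omega>: "\<omega> \<in> low_ideal"
    note D = low_idealD[OF \<omega>]
    have "(\<lambda>xs. - \<omega> xs) \<in> low_ideal"
    proof (rule low_idealI)
      show "(\<lambda>xs. - \<omega> xs) \<in> carrier (univ_forms G)" using D(1) by (simp add: univ_forms_def)
      show "pair_sum (\<lambda>xs. - \<omega> xs) x g v = 0" if "x \<in> carrier G" "g \<in> C \<union> {\<one>}" for x g v
        using pair_sum_eq_smult[of g "\<lambda>xs. - \<omega> xs" x "-1" \<omega> v] D(4)[OF that] by simp
    qed (use D(2,3) in auto)
    then show "\<ominus>\<^bsub>univ_forms G\<^esub> \<omega> \<in> low_ideal" using neg D(1) by simp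
  next
    fix \<omega> \<eta> assume \<omega>: "\<omega> \<in> low_ideal" and \<eta>: "\<eta> \<in> low_ideal"
    note D = low_idealD[OF \<omega>] and D' = low_idealD[OF \<eta>]
    show "\<omega> \<oplus>\<^bsub>univ_forms G\<^esub> \<eta> \<in> low_ideal"
    proof (rule low_idealI)
      show "\<omega> \<oplus>\<^bsub>univ_forms G\<^esub> \<eta> \<in> carrier (univ_forms G)" using D(1) D'(1) by blast
      show "pair_sum (\<omega> \<oplus>\<^bsub>univ_forms G\<^esub> \<eta>) x g v = 0" if "x \<in> carrier G" "g \<in> C \<union> {\<one>}" for x g v
      proof -
        have "pair_sum (\<omega> \<oplus>\<^bsub>univ_forms G\<^esub> \<eta>) x g v = pair_sum \<omega> x g v + pair_sum \<eta> x g v"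
          unfolding pair_sum_def univ_forms_simps sum.distrib[symmetric]
          by (intro sum.cong refl) (simp add: scale_left_distrib)
        then show ?thesis using D(4) D'(4) that by simp
      qed
    qed (use D(2,3) D'(2,3) in \<open>auto simp: univ_forms_simps\<close>)
  qed
  fix \<omega> \<eta> assume \<omega>: "\<omega> \<in> low_ideal" and \<eta>: "\<eta> \<in> carrier (univ_forms G)"
  note D = low_idealD[OF \<omega>]
  show "\<eta> \<otimes>\<^bsub>univ_forms G\<^esub> \<omega> \<in> low_ideal"
  proof (rule low_idealI)
    show "\<eta> \<otimes>\<^bsub>univ_forms G\<^esub> \<omega> \<in> carrier (univ_forms G)" using D(1) \<eta> by blast
    show "pair_sum (\<eta> \<otimes>\<^bsub>univ_forms G\<^esub> \<omega>) x g v = 0" if x: "x \<in> carrier G" and g: "g \<in> C \<union> {\<one>}" for x g v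
    proof -
      have "(\<eta> \<otimes>\<^bsub>univ_forms G\<^esub> \<omega>) [x, x \<otimes> a, x \<otimes> g] = \<eta> [x] * \<omega> [x, x \<otimes> a, x \<otimes> g]"
        if "a \<in> C" "b \<in> C" "a \<otimes> b = g" for a b
        using D(2)[of "x \<otimes> g" a] D(3)[of "x \<otimes> a" b] that x
        by (auto simp: univ_forms_simps univ_mult_short m_assoc)
      from pair_sum_eq_smult[of g "\<eta> \<otimes>\<^bsub>univ_forms G\<^esub> \<omega>" x "\<eta> [x]" \<omega>, OF this] show ?thesis using D(4)[OF x g] by simp
    qed
  qed (use D(2,3) in \<open>auto simp: univ_forms_simps univ_mult_short\<close>)
  show "\<omega> \<otimes>\<^bsub>univ_forms G\<^esub> \<eta> \<in> low_ideal"
  proof (rule low_idealI)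
    show "\<omega> \<otimes>\<^bsub>univ_forms G\<^esub> \<eta> \<in> carrier (univ_forms G)" using D(1) \<eta> by blast
    show "pair_sum (\<omega> \<otimes>\<^bsub>univ_forms G\<^esub> \<eta>) x g v = 0" if x: "x \<in> carrier G" and g: "g \<in> C \<union> {\<one>}" for x g v
    proof -
      have "(\<omega> \<otimes>\<^bsub>univ_forms G\<^esub> \<eta>) [x, x \<otimes> a, x \<otimes> g] = \<eta> [x \<otimes> g] * \<omega> [x, x \<otimes> a, x \<otimes> g]"
        if "a \<in> C" for a
        using D(2)[of x a] D(3)[of x a] that x by (simp add: univ_forms_simps univ_mult_short)
      from pair_sum_eq_smult[of g "\<omega> \<otimes>\<^bsub>univ_forms G\<^esub> \<eta>" x "\<eta> [x \<otimes> g]" \<omega>, OF this] show ?thesis using D(4)[OF x g] by simp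
    qed
  qed (use D(2,3) in \<open>auto simp: univ_forms_simps univ_mult_short\<close>)
qed

text \<open>Stability under the differential is where \<open>g \<in> C \<union> {\<one>}\<close>
  enters. At \<open>[x, x \<otimes> a, x \<otimes> g]\<close> it evaluates \<open>\<omega>\<close>
  on the three pairs of vertices; the outer pair is an edge if \<open>g \<in> C\<close> and a
  repetition if \<open>g = \<one>\<close>, so \<open>\<omega>\<close> vanishes on all three.\<close>

lemma dg_ideal_low_ideal: "dg_ideal G low_ideal"
  unfolding dg_ideal_def
proof (intro conjI ballI allI)
  show "ideal low_ideal (univ_forms G)" by (rule ideal_low_ideal)
next
  fix \<omega> n assume \<omega>: "\<omega> \<in> low_ideal"
  note D = low_idealD[OF \<omega>]
  show "univ_part n \<omega> \<in> low_ideal"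
  proof (rule low_idealI)
    \<comment> \<open>Forms of degree two live on lists of length three, so the factor is
      \<open>1\<close> exactly for \<open>n = 2\<close>.\<close>
    show "pair_sum (univ_part n \<omega>) x g v = 0" if "x \<in> carrier G" "g \<in> C \<union> {\<one>}" for x g v
      using pair_sum_eq_smult[of g "univ_part n \<omega>" x "if n = 2 then 1 else 0" \<omega> v] D(4)[OF that]
      by (auto simp: univ_part_def)
    show "univ_part n \<omega> \<in> carrier (univ_forms G)" using D(1) by (rule univ_part_closed)
  qed (use D(2,3) in \<open>auto simp: univ_part_def\<close>)
next
  fix \<omega> assume \<omega>: "\<omega> \<in> low_ideal"
  note D = low_idealD[OF \<omega>]
  note zero = univ_forms_zeroI[OF D(1)]
  show "univ_d G \<omega> \<in> low_ideal"
  proof (rule low_idealI)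
    show "univ_d G \<omega> \<in> carrier (univ_forms G)" using finite_carrier D(1) by (rule univ_d_closed)
    fix x assume x: "x \<in> carrier G"
    show "univ_d G \<omega> [x] = 0" by (simp add: univ_d_def zero)
    show "univ_d G \<omega> [x, x \<otimes> a] = 0" if "a \<in> C" for a
      using D(2)[OF _ that] that x by (simp add: univ_d_Cons) (simp add: univ_d_def)
    fix g v assume g: "g \<in> C \<union> {\<one>}"
    show "pair_sum (univ_d G \<omega>) x g v = 0"
    proof -
      have "univ_d G \<omega> [x, x \<otimes> a, x \<otimes> g] = 0 * \<omega> [x, x \<otimes> a, x \<otimes> g]"
        if ab: "a \<in> C" "b \<in> C" "a \<otimes> b = g" for a b
      proof -
        have "\<omega> [x, x \<otimes> g] = 0"
          using g D(3)[OF x, of g] x by (auto intro: zero)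
        moreover have "\<omega> [x, x \<otimes> a] = 0" using D(3) x ab by blast
        moreover have "\<omega> [x \<otimes> a, x \<otimes> g] = 0"
          using D(3)[of "x \<otimes> a" b] x ab by (auto simp: m_assoc)
        ultimately show ?thesis by (simp add: univ_d_Cons) (simp add: univ_d_def)
      qed
      from pair_sum_eq_smult[of g "univ_d G \<omega>" x 0 \<omega>, OF this] show ?thesis by simp
    qed
  qed
qed

text \<open>A kernel element is homogeneous, so only the condition in its own degree has content,
  and this one is a component of the represented operator.\<close>

lemma connes_ker_subset: "connes_ker G sc D \<subseteq> low_ideal"
proof
  fix \<omega> assume "\<omega> \<in> connes_ker G sc D"
  then obtain n where \<omega>: "\<omega> \<in> univ_deg G n"
    and ker: "\<forall>\<psi>\<in>funs_on G. connes_rep sc D \<omega> \<psi> = (\<lambda>_. 0)"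
    by (auto simp: connes_ker_def)
  note comp = connes_ker_component[OF \<omega> ker]
  have part: "\<omega> xs = 0" if "length xs \<noteq> Suc n" for xs
  proof -
    have "univ_part n \<omega> = \<omega>" using \<omega> by (simp add: univ_deg_def)
    from fun_cong[OF this, of xs] show ?thesis using that by (simp add: univ_part_def)
  qed
  show "\<omega> \<in> low_ideal"
  proof (rule low_idealI)
    show "\<omega> \<in> carrier (univ_forms G)" using \<omega> by (simp add: univ_deg_def)
    fix x assume x: "x \<in> carrier G"
    show "\<omega> [x] = 0" if a: "a \<in> C" for a
    proof (cases "n = 0")
      case True
      \<comment> \<open>The vector \<open>\<gamma> a w\<close> witnesses that \<open>W\<close> is
        nonzero; a function in the kernel multiplies it to \<open>0\<close>.\<close>
      obtain w where "\<gamma> a w \<noteq> 0" using \<gamma>_nonzero[OF a] by blast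
      moreover have "{w. set w \<subseteq> C \<and> length w = n} = {[]}" using True by auto
      then have "sc (\<omega> [x]) (\<gamma> a w) = 0" using comp[OF x x, of "\<gamma> a w"] by simp
      ultimately show ?thesis by simp
    qed (simp add: part)
    show "\<omega> [x, x \<otimes> a] = 0" if a: "a \<in> C" for a
    proof (cases "n = 1")
      case True
      obtain w where "\<gamma> a w \<noteq> 0" using \<gamma>_nonzero[OF a] by blast
      \<comment> \<open>Among the words of length one only \<open>[a]\<close> ends at
        \<open>x \<otimes> a\<close>, so the component is a multiple of \<open>\<gamma> a w\<close>
        alone.\<close>
      moreover have "(\<Sum>b\<in>C. if b = a then sc (\<omega> [x, x \<otimes> b]) (\<gamma> b w) else 0) = 0"
      proof -
        have "(\<Sum>b\<in>C. if b = a then sc (\<omega> [x, x \<otimes> b]) (\<gamma> b w) else 0) =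
            (\<Sum>b\<in>C. if foldl (\<otimes>) x [b] = x \<otimes> a then sc (\<omega> (word_path G x [b])) (foldr \<gamma> [b] w) else 0)"
          using x a by (intro sum.cong refl) auto
        then show ?thesis
          using comp[OF x, of "x \<otimes> a" w] x a unfolding True sum_words_1 by simp
      qed
      ultimately show ?thesis using a finite_C by simp
    qed (simp add: part)
    fix g v assume g: "g \<in> C \<union> {\<one>}"
    then have gc: "g \<in> carrier G" by auto
    show "pair_sum \<omega> x g v = 0"
    proof (cases "n = 2")
      case True
      have "pair_sum \<omega> x g v = (\<Sum>a\<in>C. \<Sum>b\<in>C. if foldl (\<otimes>) x [a, b] = x \<otimes> g
          then sc (\<omega> (word_path G x [a, b])) (foldr \<gamma> [a, b] v) else 0)"
        unfolding pair_sum_def using x gc by (intro sum.cong refl) (auto simp: m_assoc)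
      then show ?thesis
        using comp[OF x, of "x \<otimes> g" v] x gc unfolding True sum_words_2 by simp
    next
      case False
      then show ?thesis by (auto simp: part pair_sum_def intro!: sum.neutral)
    qed
  qed
qed

lemma connes_ideal_subset: "connes_ideal G sc D \<subseteq> low_ideal"
  unfolding connes_ideal_def using dg_ideal_low_ideal connes_ker_subset by blast

section \<open>Woronowicz relations and their lifts to universal 2-forms\<close>

text \<open>The hypothesis on \<open>P\<close> is invariance under the permutation of pairs that
  defines the braiding, so the indicator of \<open>P\<close> is a tensor fixed by the braiding and
  hence a relation. A universal 2-form lifting it must lie in the Connes ideal, so in
  \<open>low_ideal\<close>, and its \<open>pair_sum\<close> is the sum in question.\<close>

lemma woronowicz_relation:
  assumes contains: "contains_woronowicz_rels G C sc D"
    and inv: "\<And>a b. a \<in> C \<Longrightarrow> b \<in> C \<Longrightarrow> P (a \<otimes> b \<otimes> inv a) a \<longleftrightarrow> P a b"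
    and g: "g \<in> C \<union> {\<one>}"
  shows "(\<Sum>a\<in>C. \<Sum>b\<in>C. if a \<otimes> b = g \<and> P a b then \<gamma> a (\<gamma> b v) else 0) = 0"
proof -
  \<comment> \<open>The lift \<open>\<omega>\<close> is the indicator of the paths whose words
    satisfy \<open>P\<close>; its image \<open>t\<close> is the sum of the corresponding words
    \<open>[a, b]\<close> with coefficient one.\<close>
  define \<omega> :: "'g list \<Rightarrow> complex" where "\<omega> = (\<lambda>xs.
    if \<exists>x\<in>carrier G. \<exists>a\<in>C. \<exists>b\<in>C. P a b \<and> xs = [x, x \<otimes> a, x \<otimes> a \<otimes> b] then 1 else 0)"
  define t :: "'g \<Rightarrow> 'g list \<Rightarrow> complex" where "t = (\<lambda>x w.
    if x \<in> carrier G \<and> (\<exists>a\<in>C. \<exists>b\<in>C. P a b \<and> w = [a, b]) then 1 else 0)"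
  have \<omega>_cl: "\<omega> \<in> carrier (univ_forms G)"
  proof -
    have "{xs. \<omega> xs \<noteq> 0} \<subseteq> (\<lambda>(x, a, b). [x, x \<otimes> a, x \<otimes> a \<otimes> b]) ` (carrier G \<times> C \<times> C)"
      by (auto simp: \<omega>_def image_iff split: if_splits)
    then have "finite {xs. \<omega> xs \<noteq> 0}"
      by (rule finite_subset) (use finite_carrier finite_C in auto)
    moreover have "xs \<noteq> [] \<and> set xs \<subseteq> carrier G \<and> distinct_adj xs" if "\<omega> xs \<noteq> 0" for xs
    proof -
      obtain x a b where xab: "x \<in> carrier G" "a \<in> C" "b \<in> C" and xs: "xs = [x, x \<otimes> a, x \<otimes> a \<otimes> b]"
        using \<open>\<omega> xs \<noteq> 0\<close> by (auto simp: \<omega>_def split: if_splits)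
      have "y \<noteq> y \<otimes> c" if "y \<in> carrier G" "c \<in> C" for y c
        using that one_notin by (metis C_carrier l_cancel_one')
      then show ?thesis using xab unfolding xs by simp
    qed
    ultimately show ?thesis by (simp add: univ_forms_def)
  qed
  have t: "univ_to_tens G C \<omega> = t"
  proof (intro ext)
    fix x w
    have "\<omega> (word_path G x w) \<noteq> 0 \<longleftrightarrow> (\<exists>a\<in>C. \<exists>b\<in>C. P a b \<and> w = [a, b])"
      if "x \<in> carrier G" "set w \<subseteq> C"
    proof -
      have "word_path G x w = [y, y \<otimes> a, y \<otimes> a \<otimes> b] \<longleftrightarrow> y = x \<and> w = [a, b]"
        if "y \<in> carrier G" "a \<in> C" "b \<in> C" for y a b
      proof -
        have "word_path G x w = word_path G x [a, b] \<longleftrightarrow> w = [a, b]"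
          using \<open>x \<in> carrier G\<close> \<open>set w \<subseteq> C\<close> that C_subset
          by (intro word_path_inject[OF group_axioms]) auto
        moreover have "y = x" if "word_path G x w = [y, y \<otimes> a, y \<otimes> a \<otimes> b]"
          using that hd_word_path[of G x w] by simp
        ultimately show ?thesis by auto
      qed
      then show ?thesis using \<open>x \<in> carrier G\<close> by (auto simp: \<omega>_def)
    qed
    moreover have "\<omega> xs = 0 \<or> \<omega> xs = 1" for xs by (simp add: \<omega>_def)
    ultimately show "univ_to_tens G C \<omega> x w = t x w"
      unfolding univ_to_tens_def t_def by (smt (verit) empty_subsetI insert_subset list.set)
  qed
  have t_cl: "t \<in> carrier (tens_alg G C)"
  proof -
    have "{(x, w). t x w \<noteq> 0} \<subseteq> (\<lambda>(x, a, b). (x, [a, b])) ` (carrier G \<times> C \<times> C)"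
      by (auto simp: t_def image_iff split: if_splits)
    then have "finite {(x, w). t x w \<noteq> 0}"
      by (rule finite_subset) (use finite_carrier finite_C in auto)
    then show ?thesis by (auto simp: tens_alg_def t_def split: if_splits)
  qed
  have "braiding G C t = t"
  proof (intro ext)
    fix x w
    show "braiding G C t x w = t x w"
    proof (cases "\<exists>c\<in>C. \<exists>d\<in>C. w = [c, d]")
      case True
      then obtain c d where cd: "c \<in> C" "d \<in> C" "w = [c, d]" by blast
      \<comment> \<open>The pair \<open>(d, e)\<close> is the only one that the braiding sends to
        \<open>(c, d)\<close>, so the double sum has a single nonzero term.\<close>
      define e where "e = inv d \<otimes> c \<otimes> d"
      have e: "e \<in> C" using conj_closed[of "inv d" c] cd by (simp add: e_def)
      have de: "d \<otimes> b \<otimes> inv d = c \<longleftrightarrow> b = e" if "b \<in> C" for b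
      proof -
        have "d \<otimes> b \<otimes> inv d = c \<longleftrightarrow> d \<otimes> b = c \<otimes> d"
          using that cd by (intro inv_solve_right') auto
        also have "\<dots> \<longleftrightarrow> b = inv d \<otimes> (c \<otimes> d)"
          using inv_solve_left[of b d "c \<otimes> d"] that cd by auto
        finally show ?thesis using cd by (simp add: e_def m_assoc)
      qed
      have "braiding G C t x w = (\<Sum>a\<in>C. \<Sum>b\<in>C. if a = d then if b = e then t x [d, e] else 0 else 0)"
        unfolding braiding_def
      proof (intro sum.cong refl)
        fix a b assume "a \<in> C" "b \<in> C"
        then have "w = [a \<otimes> b \<otimes> inv a, a] \<longleftrightarrow> a = d \<and> b = e"
          using de cd(3) by (metis list.inject)
        then show "t x [a, b] * (if w = [a \<otimes> b \<otimes> inv a, a] then 1 else 0) =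
            (if a = d then if b = e then t x [d, e] else 0 else 0)"
          by simp
      qed
      also have "\<dots> = (\<Sum>a\<in>C. if a = d then t x [d, e] else 0)"
        using finite_C e by (intro sum.cong refl) auto
      also have "\<dots> = t x [d, e]" using finite_C cd by simp
      also have "\<dots> = t x w"
        using inv[of d e] de[of e] e cd by (auto simp: t_def)
      finally show ?thesis .
    next
      case False
      \<comment> \<open>Stability of \<open>C\<close> under conjugation keeps the images of words of
        length two inside \<open>C\<close>.\<close>
      then have "braiding G C t x w = 0"
        unfolding braiding_def using conj_closed by (intro sum.neutral ballI) auto
      then show ?thesis using False by (auto simp: t_def)
    qed
  qed
  then have "t \<in> woronowicz_rels G C"
    using t_cl by (auto simp: woronowicz_rels_def t_def split: if_splits)
  interpret T: ring "tens_alg G C"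
    using group_axioms finite_carrier C_subset by (rule ring_tens_alg)
  have rels: "woronowicz_rels G C \<subseteq> carrier (tens_alg G C)" by (auto simp: woronowicz_rels_def)
  interpret I: ideal "woronowicz_ideal G C" "tens_alg G C"
    unfolding woronowicz_ideal_def by (rule T.genideal_ideal[OF rels])
  have "t \<in> woronowicz_ideal G C"
    unfolding woronowicz_ideal_def using T.genideal_self[OF rels] \<open>t \<in> woronowicz_rels G C\<close> by blast
  then have "to_woronowicz G C \<omega> = \<zero>\<^bsub>woronowicz_alg G C\<^esub>"
    unfolding to_woronowicz_def t woronowicz_alg_def by (simp add: FactRing_def I.a_rcos_const)
  then have "to_connes G sc D \<omega> = \<zero>\<^bsub>connes_alg G sc D\<^esub>"
    using contains \<omega>_cl by (simp add: contains_woronowicz_rels_def)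
  then have eq: "connes_ideal G sc D +>\<^bsub>univ_forms G\<^esub> \<omega> = connes_ideal G sc D"
    by (simp add: to_connes_def connes_alg_def FactRing_def)
  interpret R: ring "univ_forms G" using finite_carrier by (rule ring_univ_forms)
  \<comment> \<open>Every ideal in the intersection contains \<open>0\<close>, so
    \<open>0 + \<omega>\<close> lies in the coset of \<open>\<omega>\<close>, which by
    \<open>eq\<close> is the ideal itself.\<close>
  have "\<zero>\<^bsub>univ_forms G\<^esub> \<in> connes_ideal G sc D"
    by (auto simp: connes_ideal_def dg_ideal_def intro!: additive_subgroup.zero_closed ideal.axioms(1))
  then have "\<zero>\<^bsub>univ_forms G\<^esub> \<oplus>\<^bsub>univ_forms G\<^esub> \<omega> \<in> connes_ideal G sc D +>\<^bsub>univ_forms G\<^esub> \<omega>"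
    by (auto simp: a_r_coset_def')
  then have "\<omega> \<in> low_ideal"
    using \<omega>_cl eq connes_ideal_subset by auto
  \<comment> \<open>The coefficients of \<open>\<omega>\<close> do not depend on the base point, so
    the identity serves as one.\<close>
  then have pair: "pair_sum \<omega> \<one> g v = 0" using g by (intro low_idealD) auto
  have val: "\<omega> [\<one>, a, a \<otimes> b] = (if P a b then 1 else 0)" if ab: "a \<in> C" "b \<in> C" for a b
  proof -
    have "[\<one>, a, a \<otimes> b] = [y, y \<otimes> c, y \<otimes> c \<otimes> d] \<longleftrightarrow> y = \<one> \<and> c = a \<and> d = b"
      if "y \<in> carrier G" "c \<in> C" "d \<in> C" for y c d
      using that ab by auto
    then show ?thesis using ab by (auto simp: \<omega>_def)
  qed
  have "pair_sum \<omega> \<one> g v = (\<Sum>a\<in>C. \<Sum>b\<in>C. if a \<otimes> b = g \<and> P a b then \<gamma> a (\<gamma> b v) else 0)"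
    unfolding pair_sum_def
  proof (intro sum.cong refl)
    fix a b assume "a \<in> C" "b \<in> C"
    then show "(if a \<otimes> b = g then sc (\<omega> [\<one>, \<one> \<otimes> a, \<one> \<otimes> g]) (\<gamma> a (\<gamma> b v)) else 0) =
        (if a \<otimes> b = g \<and> P a b then \<gamma> a (\<gamma> b v) else 0)"
      using val[of a b] by (cases "a \<otimes> b = g") auto
  qed
  with pair show ?thesis by simp
qed

end


theorem theorem5p6:
  fixes G :: "('g, 'm) monoid_scheme"
    and C :: "'g set"
    and sc :: "complex \<Rightarrow> 'w \<Rightarrow> 'w::ab_group_add"
    and \<rho> \<gamma> :: "'g \<Rightarrow> 'w \<Rightarrow> 'w"
    and A :: "'g \<Rightarrow> 'g \<Rightarrow> 'g \<Rightarrow> complex"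
  assumes "group G" and "finite (carrier G)"
    and "C \<subseteq> carrier G" and "\<one>\<^bsub>G\<^esub> \<notin> C"
    and "\<And>g c. g \<in> carrier G \<Longrightarrow> c \<in> C \<Longrightarrow> g \<otimes>\<^bsub>G\<^esub> c \<otimes>\<^bsub>G\<^esub> inv\<^bsub>G\<^esub> g \<in> C"
    and "vector_space sc"
    and "linear_rep G sc \<rho>"
    and "\<And>a. a \<in> C \<Longrightarrow> Vector_Spaces.linear sc sc (\<gamma> a)"
    and "\<And>a. a \<in> C \<Longrightarrow> \<gamma> a \<noteq> (\<lambda>_. 0)"
    and "\<And>a b. a \<in> C \<Longrightarrow> b \<in> C \<Longrightarrow> A b a \<in> funs_on G"
    and "contains_woronowicz_rels G C sc (dirac G C sc \<rho> \<gamma> A)"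
  shows "(\<forall>a\<in>C. a \<otimes>\<^bsub>G\<^esub> a \<in> C \<union> {\<one>\<^bsub>G\<^esub>} \<longrightarrow> \<gamma> a \<circ> \<gamma> a = (\<lambda>_. 0)) \<and>
    (\<forall>g\<in>C \<union> {\<one>\<^bsub>G\<^esub>}.
       (\<lambda>w. \<Sum>(a, b)\<in>{(a, b) \<in> C \<times> C. a \<otimes>\<^bsub>G\<^esub> b = g}. (\<gamma> a \<circ> \<gamma> b) w) = (\<lambda>_. 0))"
proof -
  interpret dirac_data G sc C \<rho> \<gamma> A
    using assms(1-9) by (intro dirac_data.intro dirac_data_axioms.intro)
  note rel = woronowicz_relation[OF assms(11)]
  have "(\<gamma> a \<circ> \<gamma> a) v = 0" if a: "a \<in> C" "a \<otimes>\<^bsub>G\<^esub> a \<in> C \<union> {\<one>\<^bsub>G\<^esub>}" for a v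
  proof -
    \<comment> \<open>The predicate singles out the word \<open>[a, a]\<close>. The braiding fixes
      it, and by cancellation sends no other word to it.\<close>
    have "c \<otimes>\<^bsub>G\<^esub> d \<otimes>\<^bsub>G\<^esub> inv\<^bsub>G\<^esub> c = a \<and> c = a \<longleftrightarrow> c = a \<and> d = a" if "c \<in> C" "d \<in> C" for c d
    proof -
      have "a \<otimes>\<^bsub>G\<^esub> d \<otimes>\<^bsub>G\<^esub> inv\<^bsub>G\<^esub> a = a \<longleftrightarrow> a \<otimes>\<^bsub>G\<^esub> d = a \<otimes>\<^bsub>G\<^esub> a"
        using that a(1) by (intro inv_solve_right') auto
      also have "\<dots> \<longleftrightarrow> d = a" using that a(1) by simp
      finally show ?thesis by auto
    qed
    from rel[of "\<lambda>c d. c = a \<and> d = a", OF this a(2)]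
    have "0 = (\<Sum>c\<in>C. \<Sum>d\<in>C. if c \<otimes>\<^bsub>G\<^esub> d = a \<otimes>\<^bsub>G\<^esub> a \<and> c = a \<and> d = a then \<gamma> c (\<gamma> d v) else 0)"
      by simp
    also have "\<dots> = (\<Sum>c\<in>C. if c = a then \<Sum>d\<in>C. if d = a then \<gamma> a (\<gamma> a v) else 0 else 0)"
      by (intro sum.cong refl) (auto intro!: sum.cong)
    also have "\<dots> = \<gamma> a (\<gamma> a v)" using a finite_C by simp
    finally show ?thesis by simp
  qed
  moreover have "(\<Sum>(a, b)\<in>{(a, b) \<in> C \<times> C. a \<otimes>\<^bsub>G\<^esub> b = g}. (\<gamma> a \<circ> \<gamma> b) v) = 0"
    if g: "g \<in> C \<union> {\<one>\<^bsub>G\<^esub>}" for g v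
  proof -
    \<comment> \<open>The braiding preserves the product of the two letters, so prescribing this
      product is an invariant condition.\<close>
    have "c \<otimes>\<^bsub>G\<^esub> d \<otimes>\<^bsub>G\<^esub> inv\<^bsub>G\<^esub> c \<otimes>\<^bsub>G\<^esub> c = g \<longleftrightarrow> c \<otimes>\<^bsub>G\<^esub> d = g" if "c \<in> C" "d \<in> C" for c d
      using that by (simp add: m_assoc)
    from rel[of "\<lambda>c d. c \<otimes>\<^bsub>G\<^esub> d = g", OF this g]
    have "0 = (\<Sum>(a, b)\<in>C \<times> C. if a \<otimes>\<^bsub>G\<^esub> b = g then \<gamma> a (\<gamma> b v) else 0)"
      by (simp add: sum.cartesian_product)
    also have "\<dots> = (\<Sum>(a, b)\<in>{(a, b) \<in> C \<times> C. a \<otimes>\<^bsub>G\<^esub> b = g}. (\<gamma> a \<circ> \<gamma> b) v)"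
      using finite_C by (intro sum.mono_neutral_cong_right) (auto split: if_splits)
    finally show ?thesis by simp
  qed
  ultimately show ?thesis by (auto simp: fun_eq_iff)
qed

end
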